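(* Let $\ell\ge1$. Define polynomials $g_{\ell,n}^m(q,x)$ for integers $n\ge m\ge0$ by $g_{\ell,n}^n(q,x)=g_{\ell,n}(q,x)$ and $$g_{\ell,n}^m(q,x)=g_{\ell,n}^{m+1}(q,x)-x\,q^{\ell(n-m-1)}g_{\ell,n-1}^m(q,x)\qquad(0\le m\le n-1).$$ Then for all $n\ge m\ge0$, $$g_{\ell,n}^m(q,x)=\sum_{k=0}^{n-m}(-x)^k{n-m\brack k}_{q^\ell}q^{\ell\binom{k}{2}}g_{\ell,n-k}(q,x),$$ and $$g_{\ell,n}^m(q,x)=\sum_{\sigma\in G_{\ell,n}^m}q^{\mathrm{fmaf}\,\sigma}x^{\mathrm{fix}\,\sigma}.$$
   Context: Let $\ell,n\ge 1$, $\zeta=e^{2\pi i/\ell}$, $C_\ell=\{1,\zeta,\dots,\zeta^{\ell-1}\}$, $\Sigma_{\ell,n}=\{\zeta^jk:0\le j\le\ell-1,\ 1\le k\le n\}$. $G_{\ell,n}$ is the set of permutations $\sigma$ of $\Sigma_{\ell,n}$ with $\sigma(\zeta^jk)=\zeta^j\sigma(k)$, written as the word $x_1\cdots x_n$ with $x_i=\sigma(i)$ ($G_{\ell,0}$ consists of the empty permutation). For $x=\zeta^jk$ write $\varepsilon_x=\zeta^j$, $|x|=k$. Order $C_\ell$ by $1>\zeta>\cdots>\zeta^{\ell-1}$ and $\Sigma_{\ell,n}$ by: $x<y$ iff $\varepsilon_x<\varepsilon_y$, or $\varepsilon_x=\varepsilon_y$ and $|x|<|y|$ ($i\in[n]$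 identified with $\zeta^0i$). For a word $w_1\cdots w_m$, $\mathrm{maj}\,w=\sum_{i=1}^{m-1}i\,\chi(w_i>w_{i+1})$. For $\sigma\in G_{\ell,n}$: $\mathrm{FIX}(\sigma)=\{i:x_i=i\}$, $\mathrm{fix}\,\sigma=|\mathrm{FIX}(\sigma)|$; $\mathrm{col}\,\sigma=\sum_i j_i$ where $x_i=\zeta^{j_i}|x_i|$, $0\le j_i<\ell$. $\mathrm{Der}(\sigma)$: delete fixed points to get $y_1\cdots y_m$, then $\mathrm{Der}(\sigma)=z_1\cdots z_m$, $z_i=\varepsilon_{y_i}\mathrm{rank}(|y_i|)$ with rank the increasing bijection $\{|y_1|,\dots,|y_m|\}\to[m]$. If $\mathrm{FIX}(\sigma)=\{i_1<\dots<i_k\}$, $\mathrm{maf}\,\sigma=\mathrm{maj}\,\mathrm{Der}(\sigma)+\sum_{j=1}^k(i_j-j)$, and $\mathrm{fmaf}\,\sigma=\ell\,\mathrm{maf}\,\sigma+\mathrm{col}\,\sigma$. $G_{\ell,n}^m=\{\sigma\in G_{\ell,n}:\sigma(i)\ne i\text{ for all }i\le n-m\}$. $[n]_q=1+q+\dots+q^{n-1}$; $(a;q)_n=\prod_{k=0}^{n-1}(1-aq^k)$; ${n\brack m}_q=\frac{(q;q)_n}{(q;q)_m(q;q)_{n-m}}$. For $n\ge0$, $$g_{\ell,n}(q,x)=[\ell]_q[2\ell]_q\cdots[n\ell]_q\sum_{k=0}^n\frac{(x-1)(x-q^\ell)\cdots(x-q^{\ell(k-1)})}{[\ell]_q[2\ell]_q\cdots[k\ell]_q}.$$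 *)

theory Defs
  imports "HOL-Computational_Algebra.Polynomial"
begin

text \<open>An element zeta^j k of Sigma_{l,n} is encoded as the pair (j, k) with 0 <= j < l.
  A colored permutation sigma in G_{l,n} is encoded as its word x_1 ... x_n,
  i.e. a list of length n of such pairs whose absolute values form a permutation of [n].\<close>

definition colperms :: "nat \<Rightarrow> nat \<Rightarrow> (nat \<times> nat) list set" where
  "colperms l n = {w. length w = n \<and> (\<forall>p\<in>set w. fst p < l)
                      \<and> distinct (map snd w) \<and> set (map snd w) = {1..n}}"

text \<open>Order on Sigma: x < y iff eps_x < eps_y (with 1 > zeta > ... > zeta^(l-1), i.e.
  larger colour index = smaller), or same colour and |x| < |y|.\<close>
definition sig_less :: "nat \<times> nat \<Rightarrow> nat \<times> nat \<Rightarrow> bool" where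
  "sig_less a b \<longleftrightarrow> fst a > fst b \<or> (fst a = fst b \<and> snd a < snd b)"

definition maj :: "(nat \<times> nat) list \<Rightarrow> nat" where
  "maj w = (\<Sum>i\<in>{1..<length w}. if sig_less (w ! i) (w ! (i - 1)) then i else 0)"

definition FIX :: "(nat \<times> nat) list \<Rightarrow> nat set" where
  "FIX w = {i \<in> {1..length w}. w ! (i - 1) = (0, i)}"

definition fixp :: "(nat \<times> nat) list \<Rightarrow> nat" where
  "fixp w = card (FIX w)"

definition col :: "(nat \<times> nat) list \<Rightarrow> nat" where
  "col w = sum_list (map fst w)"

definition Der :: "(nat \<times> nat) list \<Rightarrow> (nat \<times> nat) list" where
  "Der w = (let ys = map (\<lambda>i. w ! (i - 1)) (filter (\<lambda>i. i \<notin> FIX w) [1..<length w + 1]);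
                A = set (map snd ys);
                rank = (\<lambda>k. card {a \<in> A. a \<le> k})
            in map (\<lambda>(j, k). (j, rank k)) ys)"

definition maf :: "(nat \<times> nat) list \<Rightarrow> nat" where
  "maf w = maj (Der w) +
     (\<Sum>j<card (FIX w). sorted_list_of_set (FIX w) ! j - (j + 1))"

definition fmaf :: "nat \<Rightarrow> (nat \<times> nat) list \<Rightarrow> nat" where
  "fmaf l w = l * maf w + col w"

definition colperms_m :: "nat \<Rightarrow> nat \<Rightarrow> nat \<Rightarrow> (nat \<times> nat) list set" where
  "colperms_m l n m = {w \<in> colperms l n. \<forall>i\<in>{1..n - m}. w ! (i - 1) \<noteq> (0, i)}"

definition qint :: "nat \<Rightarrow> 'a::comm_ring_1 \<Rightarrow> 'a" where
  "qint n q = (\<Sum>i<n. q ^ i)"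

text \<open>(q;q)_n as an integer polynomial, and the Gaussian binomial as the exact quotient
  (q;q)_n / ((q;q)_m (q;q)_{n-m}) in Z[q], evaluated at an element of any commutative ring.\<close>
definition qpoch_poly :: "nat \<Rightarrow> int poly" where
  "qpoch_poly n = (\<Prod>k<n. 1 - monom 1 (k + 1))"

definition qbinom_poly :: "nat \<Rightarrow> nat \<Rightarrow> int poly" where
  "qbinom_poly n m = qpoch_poly n div (qpoch_poly m * qpoch_poly (n - m))"

definition qbinom :: "nat \<Rightarrow> nat \<Rightarrow> 'a::comm_ring_1 \<Rightarrow> 'a" where
  "qbinom n m t = poly (map_poly of_int (qbinom_poly n m)) t"

text \<open>g_{l,n}(q,x); the quotient [l]_q...[n l]_q / ([l]_q...[k l]_q) is written as the
  product [(k+1) l]_q ... [n l]_q.\<close>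
definition g :: "nat \<Rightarrow> nat \<Rightarrow> 'a::comm_ring_1 \<Rightarrow> 'a \<Rightarrow> 'a" where
  "g l n q x = (\<Sum>k\<le>n. (\<Prod>i<k. x - q ^ (l * i)) * (\<Prod>i\<in>{k+1..n}. qint (i * l) q))"

text \<open>g^m_{l,n}: g^n_{l,n} = g_{l,n}, and for m < n
  g^m_{l,n} = g^{m+1}_{l,n} - x q^{l(n-m-1)} g^m_{l,n-1}. (Values for m > n are irrelevant.)\<close>
function gm :: "nat \<Rightarrow> nat \<Rightarrow> nat \<Rightarrow> 'a::comm_ring_1 \<Rightarrow> 'a \<Rightarrow> 'a" where
  "gm l n m q x = (if n \<le> m then g l n q x
     else gm l n (m + 1) q x - x * q ^ (l * (n - m - 1)) * gm l (n - 1) m q x)"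
  by auto
termination by (relation "measure (\<lambda>(l, n, m, q, x). n - m)") auto

end

theory Submission
  imports Defs
begin

text \<open>
  Put \<open>Q = q^l\<close>. A coloured permutation is determined by its set \<open>S\<close> of fixed points and its derangement
  part \<open>Der\<close>, which carries all of \<open>col\<close>, while \<open>maf\<close> splits as \<open>maj\<close> of \<open>Der\<close> plus a term depending
  only on \<open>S\<close>. Hence the sum over \<open>G_{l,n}^m\<close> is
  \<open>\<Sum>k. x^k Q^((n-m)k) [m choose k]_Q D(n-k)\<close>, with \<open>D(j)\<close> the sum of \<open>Q^maj q^col\<close> over derangements,
  and this satisfies the recurrence of \<open>gm\<close> by Pascal's rule.

  To identify \<open>D\<close>, replace \<open>maf\<close> by \<open>maj\<close>. Following Wachs, the descents of a permutation do not change when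
  its fixed points are regarded as equal letters lying above the subexcedances and coloured letters and below
  the excedances; a shuffle theorem for such words gives \<open>\<Sum>k. [n choose k]_Q D(n-k)\<close> for the sum of
  \<open>Q^maj q^col\<close> over \<open>G_{l,n}\<close>. The shuffle theorem with a single inserted letter also shows that the latter
  is \<open>[l]_q [2l]_q \<dots> [nl]_q = g l n q 1\<close>. Since \<open>g l n q x\<close> is \<open>\<Sum>k. [n choose k]_Q x^k g l (n-k) q 0\<close>
  by the q-binomial theorem, comparison at \<open>x = 1\<close> yields \<open>D(j) = g l j q 0\<close>.
\<close>

section \<open>Gaussian binomial coefficients\<close>

text \<open>Taken from Pascal's rule rather than as a quotient, so that it makes sense in every
  commutative ring.\<close>

fun gbin :: "nat \<Rightarrow> nat \<Rightarrow> 'a::comm_ring_1 \<Rightarrow> 'a" where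
  "gbin n 0 t = 1"
| "gbin 0 (Suc k) t = 0"
| "gbin (Suc n) (Suc k) t = gbin n k t + t ^ Suc k * gbin n (Suc k) t"

lemma gbin_eq_0: "n < k \<Longrightarrow> gbin n k t = 0"
  by (induction n k t rule: gbin.induct) auto

lemma gbin_self [simp]: "gbin n n t = 1"
  by (induction n) (auto simp: gbin_eq_0)

lemma qint_0 [simp]: "qint 0 t = 0"
  by (simp add: qint_def)

lemma qint_Suc: "qint (Suc n) t = qint n t + t ^ n"
  by (simp add: qint_def)

lemma qint_add: "qint (m + n) t = qint m t + t ^ m * qint n t"
  by (induction n) (simp_all add: qint_Suc power_add algebra_simps)

lemma qint_Suc': "qint (Suc n) t = 1 + t * qint n t"
  using qint_add[of 1 n t] by (simp add: qint_def)

lemma qint_mult: "qint (n * l) q = qint l q * qint n (q ^ l)"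
proof (induction n)
  case (Suc n)
  have "qint (Suc n * l) q = qint (n * l + l) q"
    by (simp add: add.commute)
  also have "\<dots> = qint (n * l) q + q ^ (n * l) * qint l q"
    by (rule qint_add)
  also have "q ^ (n * l) = (q ^ l) ^ n"
    by (metis power_mult mult.commute)
  finally show ?case
    unfolding Suc qint_Suc by (simp only: algebra_simps)
qed simp

lemma gbin_one: "gbin n (Suc 0) t = qint n t"
  by (induction n) (simp_all add: qint_Suc')

text \<open>The mirror image of Pascal's rule, with the power of \<open>t\<close> on the other
  summand. Expand both coefficients by the defining rule and use the induction hypothesis at
  \<open>k - 1\<close> and \<open>k\<close>. Later arguments choose whichever of the two rules has
  the fitting power.\<close>

lemma gbin_Suc_Suc':
  "k \<le> n \<Longrightarrow> gbin (Suc n) (Suc k) t = t ^ (n - k) * gbin n k t + gbin n (Suc k) t"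
proof (induction n arbitrary: k)
  case 0
  then show ?case by simp
next
  case (Suc n)
  show ?case
  proof (cases k)
    case 0
    then show ?thesis
      using qint_Suc[of "Suc n" t] by (simp only: gbin_one gbin.simps(1)) simp
  next
    case (Suc j)
    have j: "j \<le> n" using Suc Suc.prems by simp
    show ?thesis
    proof (cases "j = n")
      case True
      then show ?thesis using Suc by (simp add: gbin_eq_0)
    next
      case False
      then have lt: "Suc j \<le> n" using j by simp
      obtain d where d: "n = Suc j + d" using lt le_Suc_ex by blast
      have "gbin (Suc (Suc n)) (Suc k) t =
          (t ^ (n - j) * gbin n j t + gbin n (Suc j) t)
          + t ^ Suc k * (t ^ (n - Suc j) * gbin n (Suc j) t + gbin n (Suc (Suc j)) t)"
        unfolding Suc gbin.simps(3)[of "Suc n" "Suc j"] Suc.IH[OF j, symmetric] Suc.IH[OF lt, symmetric] ..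
      also have "\<dots> = t ^ (Suc n - k) * gbin (Suc n) k t + gbin (Suc n) (Suc k) t"
        unfolding Suc gbin.simps(3) d by (simp add: power_add algebra_simps)
      finally show ?thesis .
    qed
  qed
qed

text \<open>The ratio of neighbouring coefficients, cross-multiplied to avoid division. In the
  induction step with \<open>k \<le> n\<close>, both sides equal
  \<open>gbin n k t * qint (Suc n) t\<close>; each of the two forms of Pascal's rule serves one
  side.\<close>

lemma gbin_step:
  "k \<le> n \<Longrightarrow> gbin n k t * qint (n - k) t = gbin n (Suc k) t * qint (Suc k) t"
proof (induction n arbitrary: k)
  case 0
  then show ?case by simp
next
  case (Suc n)
  show ?case
  proof (cases "k \<le> n")
    case False
    then have "k = Suc n" using Suc.prems by simp
    then show ?thesis by (simp add: gbin_eq_0)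
  next
    case k: True
    have "Suc n = Suc k + (n - k)" using k by simp
    then have split: "qint (Suc n) t = qint (Suc k) t + t ^ Suc k * qint (n - k) t"
      using qint_add[of "Suc k" "n - k" t] by simp
    have "gbin (Suc n) (Suc k) t * qint (Suc k) t
        = gbin n k t * qint (Suc k) t + t ^ Suc k * (gbin n (Suc k) t * qint (Suc k) t)"
      by (simp add: algebra_simps)
    also have "\<dots> = gbin n k t * qint (Suc n) t"
      unfolding Suc.IH[OF k, symmetric] split by (simp add: algebra_simps)
    finally have R: "gbin (Suc n) (Suc k) t * qint (Suc k) t = gbin n k t * qint (Suc n) t" .
    have "gbin (Suc n) k t * qint (Suc n - k) t = gbin n k t * qint (Suc n) t"
    proof (cases k)
      case 0
      then show ?thesis by simp
    next
      case (Suc j)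
      have j: "j \<le> n" using k Suc by simp
      have "Suc n = (n - j) + Suc j" using j by simp
      then have split': "qint (Suc n) t = qint (n - j) t + t ^ (n - j) * qint (Suc j) t"
        using qint_add[of "n - j" "Suc j" t] by simp
      have "gbin (Suc n) k t * qint (Suc n - k) t
          = t ^ (n - j) * (gbin n j t * qint (n - j) t) + gbin n (Suc j) t * qint (n - j) t"
        unfolding Suc gbin_Suc_Suc'[OF j] by (simp add: algebra_simps)
      then show ?thesis
        unfolding Suc.IH[OF j] split' Suc by (simp add: algebra_simps)
    qed
    with R show ?thesis by simp
  qed
qed

text \<open>Apply \<open>gbin_step\<close> at \<open>Suc n\<close>, then Pascal's rule, then
  \<open>gbin_step\<close> at \<open>n\<close>. This is what carries the factor
  \<open>qint (Suc n * l) q\<close> of the recurrence for \<open>g\<close> through the coefficients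
  in \<open>g_expand\<close>.\<close>

lemma gbin_absorb:
  assumes "k \<le> n"
  shows "gbin (Suc n) k t * qint (Suc n - k) t = gbin n k t * qint (Suc n) t"
proof -
  have "Suc n = Suc k + (n - k)" using assms by simp
  then have split: "qint (Suc n) t = qint (Suc k) t + t ^ Suc k * qint (n - k) t"
    using qint_add[of "Suc k" "n - k" t] by simp
  have "gbin (Suc n) k t * qint (Suc n - k) t = gbin (Suc n) (Suc k) t * qint (Suc k) t"
    using assms by (intro gbin_step) simp
  also have "\<dots> = gbin n k t * qint (Suc k) t + t ^ Suc k * (gbin n (Suc k) t * qint (Suc k) t)"
    by (simp add: algebra_simps)
  also have "\<dots> = gbin n k t * qint (Suc n) t"
    unfolding gbin_step[OF assms, symmetric] split by (simp add: algebra_simps)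
  finally show ?thesis .
qed

section \<open>Agreement of the quotient behind \<open>qbinom\<close> with the Pascal
  recursion\<close>

lemma qpoch_poly_Suc: "qpoch_poly (Suc n) = qpoch_poly n * (1 - [:0, 1:] ^ Suc n)"
  by (simp add: qpoch_poly_def monom_altdef)

lemma qpoch_poly_nonzero: "qpoch_poly n \<noteq> 0"
proof -
  have "(1::int poly) - monom 1 (k + 1) \<noteq> 0" for k
  proof
    assume "(1::int poly) - monom 1 (k + 1) = 0"
    then have "coeff (1 - monom (1::int) (k + 1)) 0 = 0" by simp
    then show False by simp
  qed
  then show ?thesis by (simp add: qpoch_poly_def)
qed

text \<open>Makes the division in \<open>qbinom_poly\<close> exact. The induction rests on 1 -
  X^(n+1) = (1 - X^(j+1)) + X^(j+1) (1 - X^(d+1)), where n = j + 1 + d.\<close>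

lemma qpoch_poly_gbin:
  "k \<le> n \<Longrightarrow> qpoch_poly n = gbin n k ([:0, 1:]) * (qpoch_poly k * qpoch_poly (n - k))"
proof (induction n arbitrary: k)
  case 0
  then show ?case by (simp add: qpoch_poly_def)
next
  case (Suc n)
  let ?X = "[:0, 1::int:]"
  show ?case
  proof (cases k)
    case 0
    then show ?thesis by (simp add: qpoch_poly_def)
  next
    case (Suc j)
    have j: "j \<le> n" using Suc Suc.prems by simp
    show ?thesis
    proof (cases "j = n")
      case True
      then show ?thesis using Suc by (simp add: qpoch_poly_def)
    next
      case False
      then obtain d where d: "n = Suc j + d" using j le_Suc_ex[of "Suc j" n] by auto
      have 1: "qpoch_poly n = gbin n j ?X * (qpoch_poly j * qpoch_poly (Suc d))"
        using Suc.IH[OF j] d by simp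
      have 2: "qpoch_poly n = gbin n (Suc j) ?X * (qpoch_poly (Suc j) * qpoch_poly d)"
        using Suc.IH[of "Suc j"] d by simp
      have "qpoch_poly (Suc n) = qpoch_poly n * (1 - ?X ^ Suc j) + ?X ^ Suc j * (qpoch_poly n * (1 - ?X ^ Suc d))"
        unfolding qpoch_poly_Suc d by (simp add: power_add algebra_simps)
      also have "qpoch_poly n * (1 - ?X ^ Suc j) = gbin n j ?X * (qpoch_poly (Suc j) * qpoch_poly (Suc d))"
        unfolding 1 qpoch_poly_Suc[of j] by (simp add: mult_ac)
      also have "qpoch_poly n * (1 - ?X ^ Suc d) = gbin n (Suc j) ?X * (qpoch_poly (Suc j) * qpoch_poly (Suc d))"
        unfolding 2 qpoch_poly_Suc[of d] by (simp add: mult_ac)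
      finally show ?thesis
        using d Suc by (simp add: algebra_simps)
    qed
  qed
qed

lemma poly_of_int_poly_add:
  "poly (map_poly of_int (p + r)) t
    = poly (map_poly of_int p) t + poly (map_poly of_int r) (t::'a::comm_ring_1)"
  by (induction p r rule: poly_induct2) (simp_all add: map_poly_pCons algebra_simps)

text \<open>Pascal's rule involves only sums and multiplication by powers of the indeterminate, so
  this and additivity suffice to evaluate \<open>gbin\<close> over the integer polynomials.\<close>

lemma poly_of_int_poly_X_power:
  "poly (map_poly of_int ([:0, 1:] ^ k * p)) t = t ^ k * poly (map_poly of_int p) (t::'a::comm_ring_1)"
  by (induction k) (simp_all add: map_poly_pCons mult.assoc)

lemma poly_of_int_gbin:
  "poly (map_poly of_int (gbin n k ([:0, 1:]))) t = gbin n k (t::'a::comm_ring_1)"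
  by (induction n k t rule: gbin.induct)
    (simp_all add: poly_of_int_poly_add poly_of_int_poly_X_power del: power_Suc)

lemma qbinom_eq_gbin:
  assumes "k \<le> n"
  shows "qbinom n k t = gbin n k t"
proof -
  have "qbinom_poly n k = gbin n k ([:0, 1:])"
    unfolding qbinom_poly_def qpoch_poly_gbin[OF assms]
    by (simp add: qpoch_poly_nonzero)
  then show ?thesis
    by (simp add: qbinom_def poly_of_int_gbin)
qed

section \<open>Expansions of \<open>g\<close> and \<open>gm\<close>\<close>

lemma g_0: "g l 0 q x = 1"
  by (simp add: g_def)

text \<open>Every summand with \<open>k \<le> n\<close> gains the factor
  \<open>qint (Suc n * l) q\<close>; the new summand has an empty second product.\<close>

lemma g_Suc:
  "g l (Suc n) q x = qint (Suc n * l) q * g l n q x + (\<Prod>i<Suc n. x - q ^ (l * i))"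
proof -
  have "(\<Sum>k\<le>n. (\<Prod>i<k. x - q ^ (l * i)) * (\<Prod>i\<in>{k+1..Suc n}. qint (i * l) q))
      = (\<Sum>k\<le>n. qint (Suc n * l) q * ((\<Prod>i<k. x - q ^ (l * i)) * (\<Prod>i\<in>{k+1..n}. qint (i * l) q)))"
    by (intro sum.cong) (simp_all add: mult_ac)
  then show ?thesis
    by (simp add: g_def sum_distrib_left)
qed

lemma g_at_1: "g l n q 1 = (\<Prod>i\<in>{1..n}. qint (i * l) q)"
proof (induction n)
  case (Suc n)
  \<comment> \<open>The factor at \<open>i = 0\<close> vanishes.\<close>
  have "(\<Prod>i<Suc n. 1 - q ^ (l * i)) = 0"
    by (rule prod_zero, simp, rule bexI[of _ 0]) simp_all
  then show ?case
    unfolding g_Suc using Suc by (simp add: mult.commute)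
qed (simp add: g_0)

lemma sum_shift_0:
  fixes b :: "nat \<Rightarrow> 'a::comm_ring_1"
  assumes "b (Suc n) = 0"
  shows "(\<Sum>k\<le>n. b k) = b 0 + (\<Sum>k\<le>n. b (Suc k))"
  using sum.atMost_Suc_shift[of b n] assms by simp

text \<open>The remaining factor is kept as a product of \<open>- (t ^ i)\<close>, the value at
  \<open>x = 0\<close> of a product like the left-hand side. In this shape it occurs in the
  recurrence for \<open>g l j q 0\<close>.\<close>

lemma q_binomial_theorem:
  fixes x t :: "'a::comm_ring_1"
  shows "(\<Prod>i<n. x - t ^ i) = (\<Sum>k\<le>n. gbin n k t * x ^ k * (\<Prod>i<n - k. - (t ^ i)))"
proof (induction n)
  case (Suc n)
  define c where "c j = (\<Prod>i<j. - (t ^ i))" for j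
  have c_Suc: "c (Suc j) = - (t ^ j) * c j" for j
    by (simp add: c_def mult.commute)
  \<comment> \<open>Effect of the new factor \<open>x - t ^ n\<close>: Pascal's rule yields the two
    parts, since \<open>t ^ Suc k * c (n - k) = - (t ^ n * c (n - Suc k))\<close> for
    \<open>k < n\<close>.\<close>
  have step: "gbin (Suc n) (Suc k) t * x ^ Suc k * c (n - k)
      = x * (gbin n k t * x ^ k * c (n - k)) - t ^ n * (gbin n (Suc k) t * x ^ Suc k * c (n - Suc k))"
    if "k \<le> n" for k
  proof (cases "k = n")
    case True
    then show ?thesis by (simp add: gbin_eq_0)
  next
    case False
    with that have "Suc k \<le> n" by simp
    then obtain d where "n = Suc k + d" using le_Suc_ex by blast
    then have "t ^ Suc k * c (n - k) = - (t ^ n * c (n - Suc k))"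
      by (simp add: c_Suc power_add mult_ac)
    moreover have "gbin (Suc n) (Suc k) t * x ^ Suc k * c (n - k)
        = x * (gbin n k t * x ^ k * c (n - k)) + gbin n (Suc k) t * x ^ Suc k * (t ^ Suc k * c (n - k))"
      unfolding gbin.simps(3) power_Suc by (simp only: algebra_simps)
    ultimately show ?thesis by (simp add: mult_ac)
  qed
  have "(\<Sum>k\<le>Suc n. gbin (Suc n) k t * x ^ k * c (Suc n - k))
      = c (Suc n) + (\<Sum>k\<le>n. gbin (Suc n) (Suc k) t * x ^ Suc k * c (n - k))"
    by (subst sum.atMost_Suc_shift) simp
  also have "\<dots> = c (Suc n) + (\<Sum>k\<le>n. x * (gbin n k t * x ^ k * c (n - k))
      - t ^ n * (gbin n (Suc k) t * x ^ Suc k * c (n - Suc k)))"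
    by (intro arg_cong2[where f = "(+)"] refl sum.cong) (use step in auto)
  also have "\<dots> = x * (\<Sum>k\<le>n. gbin n k t * x ^ k * c (n - k))
      - t ^ n * (c n + (\<Sum>k\<le>n. gbin n (Suc k) t * x ^ Suc k * c (n - Suc k)))"
    unfolding sum_subtractf sum_distrib_left[symmetric] c_Suc distrib_left by simp
  also have "c n + (\<Sum>k\<le>n. gbin n (Suc k) t * x ^ Suc k * c (n - Suc k))
      = (\<Sum>k\<le>n. gbin n k t * x ^ k * c (n - k))"
    by (subst sum_shift_0[where b = "\<lambda>k. gbin n k t * x ^ k * c (n - k)"]) (auto simp: gbin_eq_0)
  also have "x * (\<Sum>k\<le>n. gbin n k t * x ^ k * c (n - k)) - t ^ n * (\<Sum>k\<le>n. gbin n k t * x ^ k * c (n - k))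
      = (\<Prod>i<Suc n. x - t ^ i)"
    using Suc.IH by (simp add: c_def[symmetric] left_diff_distrib mult.commute)
  finally show ?case by (simp add: c_def)
qed simp

text \<open>Both sides satisfy the recurrence \<open>g_Suc\<close>: \<open>gbin_absorb\<close>
  handles the multiple of the previous value, and \<open>q_binomial_theorem\<close> sums the
  inhomogeneous terms.\<close>

lemma g_expand:
  "g l n q x = (\<Sum>k\<le>n. gbin n k (q ^ l) * x ^ k * g l (n - k) q 0)"
proof (induction n)
  case (Suc n)
  define d where "d j = g l j q 0" for j
  define c where "c j = (\<Prod>i<j. - ((q ^ l) ^ i))" for j
  have d_Suc: "d (Suc j) = qint (Suc j * l) q * d j + c (Suc j)" for j
    unfolding d_def c_def g_Suc by (simp add: power_mult)
  have step: "gbin (Suc n) k (q ^ l) * x ^ k * d (Suc n - k)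
      = qint (Suc n * l) q * (gbin n k (q ^ l) * x ^ k * d (n - k))
        + gbin (Suc n) k (q ^ l) * x ^ k * c (Suc n - k)" if "k \<le> n" for k
  proof -
    have eq: "Suc n - k = Suc (n - k)" using that by simp
    have "gbin (Suc n) k (q ^ l) * qint ((Suc n - k) * l) q = gbin n k (q ^ l) * qint (Suc n * l) q"
      using gbin_absorb[OF that, of "q ^ l"] unfolding qint_mult[of _ l]
      by (simp add: mult.left_commute)
    then have absorb: "gbin (Suc n) k (q ^ l) * qint (Suc (n - k) * l) q = gbin n k (q ^ l) * qint (Suc n * l) q"
      unfolding eq .
    have "gbin (Suc n) k (q ^ l) * x ^ k * d (Suc n - k)
        = (gbin (Suc n) k (q ^ l) * qint (Suc (n - k) * l) q) * x ^ k * d (n - k)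
          + gbin (Suc n) k (q ^ l) * x ^ k * c (Suc n - k)"
      unfolding eq d_Suc by (simp only: algebra_simps)
    then show ?thesis unfolding absorb by (simp only: algebra_simps)
  qed
  have "(\<Sum>k\<le>Suc n. gbin (Suc n) k (q ^ l) * x ^ k * d (Suc n - k))
      = (\<Sum>k\<le>n. qint (Suc n * l) q * (gbin n k (q ^ l) * x ^ k * d (n - k)))
        + (\<Sum>k\<le>Suc n. gbin (Suc n) k (q ^ l) * x ^ k * c (Suc n - k))"
  proof -
    have "(\<Sum>k\<le>n. gbin (Suc n) k (q ^ l) * x ^ k * d (Suc n - k))
      = (\<Sum>k\<le>n. qint (Suc n * l) q * (gbin n k (q ^ l) * x ^ k * d (n - k))
        + gbin (Suc n) k (q ^ l) * x ^ k * c (Suc n - k))"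
      by (intro sum.cong refl step) simp
    then show ?thesis
      by (simp add: sum.distrib d_def c_def g_0 del: gbin.simps)
  qed
  also have "\<dots> = qint (Suc n * l) q * g l n q x + (\<Prod>i<Suc n. x - (q ^ l) ^ i)"
    unfolding q_binomial_theorem c_def Suc.IH d_def by (simp only: sum_distrib_left)
  also have "\<dots> = g l (Suc n) q x"
    by (simp add: g_Suc power_mult)
  finally show ?case by (simp add: d_def)
qed (simp add: g_0)

section \<open>Closed forms for the recurrence of \<open>gm\<close>\<close>

declare gm.simps [simp del]

text \<open>Reduces each closed form to a check on the diagonal and of the recurrence. Writing the
  larger index as \<open>Suc (m + d)\<close> turns the exponent \<open>n - m - 1\<close> into
  \<open>d\<close>.\<close>

lemma gm_unique:
  assumes "\<And>m. F m m = g l m q x"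
    and "\<And>m d. F (Suc (m + d)) m = F (Suc (m + d)) (Suc m) - x * q ^ (l * d) * F (m + d) m"
    and "m \<le> n"
  shows "gm l n m q x = F n m"
proof -
  have "gm l (m + d) m q x = F (m + d) m" for d
  proof (induction d arbitrary: m)
    case 0
    then show ?case using assms(1) by (subst gm.simps) simp
  next
    case (Suc d)
    then show ?case
      using assms(2)[of m d] Suc.IH[of m] Suc.IH[of "Suc m"] by (subst gm.simps) simp
  qed
  from this[of "n - m"] assms(3) show ?thesis by simp
qed

text \<open>The recurrence becomes the mirrored Pascal rule for
  \<open>gbin (Suc d) (Suc k)\<close>.\<close>

lemma gm_explicit:
  assumes "m \<le> n"
  shows "gm l n m q x = (\<Sum>k\<le>n - m. (- x) ^ k * gbin (n - m) k (q ^ l) * q ^ (l * (k choose 2)) * g l (n - k) q x)"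
proof (rule gm_unique[OF _ _ assms])
  fix m d
  let ?e = "\<lambda>k. q ^ (l * (k choose 2))" and ?b = "\<lambda>n k. gbin n k (q ^ l)" and ?G = "\<lambda>n. g l n q x"
  let ?N = "Suc (m + d)"
  have e_Suc: "?e (Suc k) = q ^ (l * k) * ?e k" for k
    by (simp add: numeral_2_eq_2 algebra_simps power_add)
  have step: "(- x) ^ Suc k * ?b (Suc d) (Suc k) * ?e (Suc k) * ?G (m + d - k)
      = (- x) ^ Suc k * ?b d (Suc k) * ?e (Suc k) * ?G (m + d - k)
        - x * q ^ (l * d) * ((- x) ^ k * ?b d k * ?e k * ?G (m + d - k))" if k: "k \<le> d" for k
  proof -
    \<comment> \<open>The power in the recurrence splits into the one demanded by Pascal's rule and
      the one that leads from \<open>?e k\<close> to \<open>?e (Suc k)\<close>.\<close>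
    have Q: "q ^ (l * d) = (q ^ l) ^ (d - k) * q ^ (l * k)"
      using k by (simp add: power_mult[symmetric] power_add[symmetric] algebra_simps)
    have "q ^ (l * d) * ((- x) ^ Suc k * ?b d k * ?e k * ?G (m + d - k))
        = (- x) ^ Suc k * ((q ^ l) ^ (d - k) * ?b d k) * ?e (Suc k) * ?G (m + d - k)"
      unfolding e_Suc Q by (simp only: power_Suc mult_ac)
    then show ?thesis
      unfolding gbin_Suc_Suc'[OF k] by (simp add: algebra_simps)
  qed
  have "(\<Sum>k\<le>Suc d. (- x) ^ k * ?b (Suc d) k * ?e k * ?G (?N - k))
      = ?G ?N + (\<Sum>k\<le>d. (- x) ^ Suc k * ?b (Suc d) (Suc k) * ?e (Suc k) * ?G (m + d - k))"
    by (subst sum.atMost_Suc_shift) (simp add: numeral_2_eq_2)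
  also have "\<dots> = (?G ?N + (\<Sum>k\<le>d. (- x) ^ Suc k * ?b d (Suc k) * ?e (Suc k) * ?G (m + d - k)))
      - x * q ^ (l * d) * (\<Sum>k\<le>d. (- x) ^ k * ?b d k * ?e k * ?G (m + d - k))"
    unfolding sum_distrib_left add_diff_eq[symmetric] sum_subtractf[symmetric]
    by (intro arg_cong2[where f = "(+)"] refl sum.cong) (use step in auto)
  also have "?G ?N + (\<Sum>k\<le>d. (- x) ^ Suc k * ?b d (Suc k) * ?e (Suc k) * ?G (m + d - k))
      = (\<Sum>k\<le>d. (- x) ^ k * ?b d k * ?e k * ?G (?N - k))"
    by (subst sum_shift_0[where b = "\<lambda>k. (- x) ^ k * ?b d k * ?e k * ?G (?N - k)"])
      (auto simp: gbin_eq_0 numeral_2_eq_2)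
  finally show "(\<Sum>k\<le>?N - m. (- x) ^ k * ?b (?N - m) k * ?e k * ?G (?N - k))
    = (\<Sum>k\<le>?N - Suc m. (- x) ^ k * ?b (?N - Suc m) k * ?e k * ?G (?N - k))
      - x * q ^ (l * d) * (\<Sum>k\<le>m + d - m. (- x) ^ k * ?b (m + d - m) k * ?e k * ?G (m + d - k))"
    by (simp add: Suc_diff_le)
qed (simp add: numeral_2_eq_2)

text \<open>The form to be met by the count over permutations, with \<open>g l (n - k) q 0\<close>
  in the place of the derangement sum. The recurrence is the defining Pascal rule for
  \<open>gbin (Suc m) (Suc k)\<close>; the diagonal is \<open>g_expand\<close>.\<close>

lemma gm_eq_derangement_sum:
  assumes "m \<le> n"
  shows "gm l n m q x = (\<Sum>k\<le>m. x ^ k * (q ^ l) ^ ((n - m) * k) * gbin m k (q ^ l) * g l (n - k) q 0)"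
proof (rule gm_unique[OF _ _ assms])
  fix m d
  let ?b = "\<lambda>n k. gbin n k (q ^ l)" and ?D = "\<lambda>n. g l n q 0" and ?Q = "q ^ l"
  let ?N = "Suc (m + d)"
  have step: "x ^ Suc k * ?Q ^ (d * Suc k) * ?b (Suc m) (Suc k) * ?D (m + d - k)
      = x ^ Suc k * ?Q ^ (Suc d * Suc k) * ?b m (Suc k) * ?D (m + d - k)
        + x * q ^ (l * d) * (x ^ k * ?Q ^ (d * k) * ?b m k * ?D (m + d - k))" for k
    unfolding power_mult[of q l d] gbin.simps(3) power_add power_Suc mult_Suc mult_Suc_right
    by (simp only: algebra_simps)
  have "(\<Sum>k\<le>Suc m. x ^ k * ?Q ^ (d * k) * ?b (Suc m) k * ?D (?N - k))
      = ?D ?N + (\<Sum>k\<le>m. x ^ Suc k * ?Q ^ (d * Suc k) * ?b (Suc m) (Suc k) * ?D (m + d - k))"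
    by (subst sum.atMost_Suc_shift) simp
  also have "\<dots> = (?D ?N + (\<Sum>k\<le>m. x ^ Suc k * ?Q ^ (Suc d * Suc k) * ?b m (Suc k) * ?D (m + d - k)))
      + x * q ^ (l * d) * (\<Sum>k\<le>m. x ^ k * ?Q ^ (d * k) * ?b m k * ?D (m + d - k))"
    unfolding step by (simp only: sum.distrib sum_distrib_left add.assoc)
  also have "?D ?N + (\<Sum>k\<le>m. x ^ Suc k * ?Q ^ (Suc d * Suc k) * ?b m (Suc k) * ?D (m + d - k))
      = (\<Sum>k\<le>m. x ^ k * ?Q ^ (Suc d * k) * ?b m k * ?D (?N - k))"
    by (subst sum_shift_0[where b = "\<lambda>k. x ^ k * ?Q ^ (Suc d * k) * ?b m k * ?D (?N - k)"])
      (auto simp: gbin_eq_0)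
  finally show "(\<Sum>k\<le>m. x ^ k * ?Q ^ ((?N - m) * k) * ?b m k * ?D (?N - k))
    = (\<Sum>k\<le>Suc m. x ^ k * ?Q ^ ((?N - Suc m) * k) * ?b (Suc m) k * ?D (?N - k))
      - x * q ^ (l * d) * (\<Sum>k\<le>m. x ^ k * ?Q ^ ((m + d - m) * k) * ?b m k * ?D (m + d - k))"
    by (simp add: Suc_diff_le algebra_simps)
next
  fix m
  show "(\<Sum>k\<le>m. x ^ k * (q ^ l) ^ ((m - m) * k) * gbin m k (q ^ l) * g l (m - k) q 0) = g l m q x"
    unfolding g_expand[of l m q x] by (simp add: mult.commute)
qed

section \<open>The shuffle theorem for the major index\<close>

text \<open>
  \<open>smaj D n\<close> is the major index of a word of length \<open>n\<close> with descent set \<open>D\<close>. In \<open>mask_des d e S\<close>, equal letters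
  \<open>*\<close> occupy the positions in \<open>S\<close> and a word \<open>u\<close> fills the others: \<open>d r\<close> says that \<open>u\<close> has a descent at \<open>r\<close>,
  and \<open>e r\<close> that \<open>u_r > *\<close>. Position \<open>i\<close> outside \<open>S\<close> holds \<open>u_{rnk S i}\<close>.
\<close>

definition smaj :: "(nat \<Rightarrow> bool) \<Rightarrow> nat \<Rightarrow> nat" where
  "smaj D n = (\<Sum>i\<in>{1..<n}. if D i then i else 0)"

lemma smaj_0 [simp]: "smaj D 0 = 0"
  by (simp add: smaj_def)

lemma smaj_Suc: "smaj D (Suc n) = smaj D n + (if D n then n else 0)"
  by (cases "n = 0") (simp_all add: smaj_def)

lemma smaj_cong: "(\<And>i. 1 \<le> i \<Longrightarrow> i < n \<Longrightarrow> D i = D' i) \<Longrightarrow> smaj D n = smaj D' n"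
  unfolding smaj_def by (rule sum.cong) auto

definition rnk :: "nat set \<Rightarrow> nat \<Rightarrow> nat" where
  "rnk S i = card ({1..i} - S)"

definition subs :: "nat \<Rightarrow> nat \<Rightarrow> nat set set" where
  "subs n k = {S. S \<subseteq> {1..n} \<and> card S = k}"

definition mask_des :: "(nat \<Rightarrow> bool) \<Rightarrow> (nat \<Rightarrow> bool) \<Rightarrow> nat set \<Rightarrow> nat \<Rightarrow> bool" where
  "mask_des d e S i \<longleftrightarrow>
     (if i \<in> S then Suc i \<notin> S \<and> \<not> e (rnk S (Suc i))
      else if Suc i \<in> S then e (rnk S i) else d (rnk S i))"

lemma finite_subs [simp]: "finite (subs n k)"
  unfolding subs_def by (rule finite_subset[of _ "Pow {1..n}"]) auto

lemma subs_0: "subs n 0 = {{}}"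
proof -
  have "card S = 0 \<longleftrightarrow> S = {}" if "S \<subseteq> {1..n}" for S
    using finite_subset[OF that] by simp
  then have "S \<in> subs n 0 \<longleftrightarrow> S = {}" for S
    unfolding subs_def by auto
  then show ?thesis by auto
qed

lemma subs_empty:
  assumes "n < k"
  shows "subs n k = {}"
proof -
  have "card S \<noteq> k" if "S \<subseteq> {1..n}" for S
    using card_mono[OF _ that] assms by simp
  then show ?thesis unfolding subs_def by blast
qed

lemma rnk_subs:
  assumes "S \<in> subs n k"
  shows "rnk S n = n - k" "k \<le> n \<Longrightarrow> rnk S (Suc n) = Suc n - k"
proof -
  have S: "S \<subseteq> {1..n}" "card S = k" "finite S"
    using assms by (auto simp: subs_def intro: finite_subset)
  then show "rnk S n = n - k"
    unfolding rnk_def by (simp add: card_Diff_subset)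
  have "S \<subseteq> {1..Suc n}" using S by auto
  then show "rnk S (Suc n) = Suc n - k"
    unfolding rnk_def using S by (simp add: card_Diff_subset)
qed

lemma rnk_insert_Suc: "i \<le> n \<Longrightarrow> rnk (insert (Suc n) S) i = rnk S i"
  unfolding rnk_def by (rule arg_cong[where f = card]) auto

lemma subs_Suc_notin: "{S \<in> subs (Suc n) k. Suc n \<notin> S} = subs n k"
  unfolding subs_def by (auto simp: atLeastAtMostSuc_conv)

lemma subs_Suc_in: "{S \<in> subs (Suc n) (Suc k). Suc n \<in> S} = insert (Suc n) ` subs n k"
proof (intro set_eqI iffI)
  fix S assume "S \<in> {S \<in> subs (Suc n) (Suc k). Suc n \<in> S}"
  then have S: "S \<subseteq> {1..Suc n}" "card S = Suc k" "Suc n \<in> S" "finite S"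
    by (auto simp: subs_def intro: finite_subset)
  then have "S - {Suc n} \<in> subs n k" "S = insert (Suc n) (S - {Suc n})"
    by (auto simp: subs_def atLeastAtMostSuc_conv)
  then show "S \<in> insert (Suc n) ` subs n k" by blast
next
  fix S assume "S \<in> insert (Suc n) ` subs n k"
  then obtain S' where S': "S = insert (Suc n) S'" "S' \<subseteq> {1..n}" "card S' = k"
    by (auto simp: subs_def)
  then have "finite S'" "Suc n \<notin> S'" by (auto intro: finite_subset)
  with S' show "S \<in> {S \<in> subs (Suc n) (Suc k). Suc n \<in> S}"
    by (auto simp: subs_def)
qed

lemma inj_on_insert_subs: "inj_on (insert (Suc n)) (subs n k)"
proof (rule inj_onI)
  fix S T assume "S \<in> subs n k" "T \<in> subs n k" and eq: "insert (Suc n) S = insert (Suc n) T"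
  then have "Suc n \<notin> S" "Suc n \<notin> T" by (auto simp: subs_def)
  with eq show "S = T" by (metis insert_ident)
qed

lemma sum_filter_split:
  "finite A \<Longrightarrow> sum f A = sum f {x \<in> A. P x} + sum f {x \<in> A. \<not> P x}"
  by (subst sum.union_disjoint[symmetric]) (auto intro: sum.cong)

lemma sum_subs_Suc:
  fixes f :: "nat set \<Rightarrow> 'a::comm_ring_1"
  shows "sum f (subs (Suc n) (Suc k)) = (\<Sum>S\<in>subs n k. f (insert (Suc n) S)) + sum f (subs n (Suc k))"
  using sum_filter_split[OF finite_subs, of f "Suc n" "Suc k" "\<lambda>S. Suc n \<in> S"]
  by (simp add: subs_Suc_notin subs_Suc_in sum.reindex[OF inj_on_insert_subs])

context
  fixes t :: "'a::comm_ring_1" and d e :: "nat \<Rightarrow> bool"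
begin

text \<open>The shuffle theorem is proved by splitting according to whether the last position carries \<open>*\<close>.\<close>

definition W :: "nat \<Rightarrow> nat \<Rightarrow> 'a" where
  "W n k = (\<Sum>S | S \<in> subs n k \<and> n \<in> S. t ^ smaj (mask_des d e S) n)"

definition V :: "nat \<Rightarrow> nat \<Rightarrow> 'a" where
  "V n k = (\<Sum>S | S \<in> subs n k \<and> n \<notin> S. t ^ smaj (mask_des d e S) n)"

lemma W_add_V: "W n k + V n k = (\<Sum>S\<in>subs n k. t ^ smaj (mask_des d e S) n)"
  unfolding W_def V_def by (rule sum_filter_split[symmetric]) simp

text \<open>The last position holds the letter of \<open>u\<close> with index
  \<open>Suc n - k\<close>. Whether \<open>n\<close> is a descent depends on position
  \<open>n\<close>: after a letter \<open>d (n - k)\<close> decides, after \<open>*\<close> it is a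
  descent unless \<open>e (Suc n - k)\<close>.\<close>

lemma V_Suc:
  assumes "k \<le> n"
  shows "V (Suc n) k = t ^ (if d (n - k) then n else 0) * V n k
                     + t ^ (if e (Suc n - k) then 0 else n) * W n k"
proof -
  have "V (Suc n) k = (\<Sum>S\<in>subs n k. t ^ smaj (mask_des d e S) (Suc n))"
    unfolding V_def subs_Suc_notin ..
  also have "\<dots> = (\<Sum>S | S \<in> subs n k \<and> n \<in> S. t ^ smaj (mask_des d e S) (Suc n))
                + (\<Sum>S | S \<in> subs n k \<and> n \<notin> S. t ^ smaj (mask_des d e S) (Suc n))"
    by (rule sum_filter_split) simp
  also have "(\<Sum>S | S \<in> subs n k \<and> n \<in> S. t ^ smaj (mask_des d e S) (Suc n))
           = t ^ (if e (Suc n - k) then 0 else n) * W n k"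
    unfolding W_def sum_distrib_left
  proof (rule sum.cong)
    fix S assume S: "S \<in> {S \<in> subs n k. n \<in> S}"
    moreover from S have "Suc n \<notin> S" by (auto simp: subs_def)
    ultimately show "t ^ smaj (mask_des d e S) (Suc n)
        = t ^ (if e (Suc n - k) then 0 else n) * t ^ smaj (mask_des d e S) n"
      using rnk_subs(2)[of S n k] assms by (simp add: smaj_Suc mask_des_def power_add)
  qed simp
  also have "(\<Sum>S | S \<in> subs n k \<and> n \<notin> S. t ^ smaj (mask_des d e S) (Suc n))
           = t ^ (if d (n - k) then n else 0) * V n k"
    unfolding V_def sum_distrib_left
  proof (rule sum.cong)
    fix S assume S: "S \<in> {S \<in> subs n k. n \<notin> S}"
    moreover from S have "Suc n \<notin> S" by (auto simp: subs_def)
    ultimately show "t ^ smaj (mask_des d e S) (Suc n)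
        = t ^ (if d (n - k) then n else 0) * t ^ smaj (mask_des d e S) n"
      using rnk_subs(1)[of S n k] by (simp add: smaj_Suc mask_des_def power_add)
  qed simp
  finally show ?thesis by (simp add: add.commute)
qed

text \<open>The last position holds \<open>*\<close>. There is no descent after another
  \<open>*\<close>; after the letter with index \<open>n - k\<close> there is one exactly if that
  letter exceeds \<open>*\<close>.\<close>

lemma W_Suc: "W (Suc n) (Suc k) = W n k + t ^ (if e (n - k) then n else 0) * V n k"
proof -
  have "W (Suc n) (Suc k) = (\<Sum>S\<in>subs n k. t ^ smaj (mask_des d e (insert (Suc n) S)) (Suc n))"
    unfolding W_def subs_Suc_in by (simp add: sum.reindex[OF inj_on_insert_subs])
  also have "\<dots> = (\<Sum>S\<in>subs n k. t ^ (smaj (mask_des d e S) n + (if n \<notin> S \<and> e (n - k) then n else 0)))"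
  proof (rule sum.cong)
    fix S assume S: "S \<in> subs n k"
    have "smaj (mask_des d e (insert (Suc n) S)) n = smaj (mask_des d e S) n"
      by (rule smaj_cong) (auto simp: mask_des_def rnk_insert_Suc)
    moreover have "mask_des d e (insert (Suc n) S) n \<longleftrightarrow> n \<notin> S \<and> e (n - k)"
      using rnk_subs(1)[OF S] by (simp add: mask_des_def rnk_insert_Suc)
    ultimately show "t ^ smaj (mask_des d e (insert (Suc n) S)) (Suc n)
        = t ^ (smaj (mask_des d e S) n + (if n \<notin> S \<and> e (n - k) then n else 0))"
      by (simp add: smaj_Suc)
  qed simp
  also have "\<dots> = (\<Sum>S | S \<in> subs n k \<and> n \<in> S. t ^ (smaj (mask_des d e S) n + (if n \<notin> S \<and> e (n - k) then n else 0)))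
     + (\<Sum>S | S \<in> subs n k \<and> n \<notin> S. t ^ (smaj (mask_des d e S) n + (if n \<notin> S \<and> e (n - k) then n else 0)))"
    by (rule sum_filter_split) simp
  also have "\<dots> = W n k + t ^ (if e (n - k) then n else 0) * V n k"
    unfolding V_def W_def sum_distrib_left
    by (intro arg_cong2[where f = "(+)"] sum.cong) (auto simp: power_add mult.commute)
  finally show ?thesis .
qed

lemma W_0: "W n 0 = 0"
  unfolding W_def by (rule sum.neutral) (auto simp: subs_0)

lemma V_W_eq_0: "n < k \<Longrightarrow> V n k = 0" "n < k \<Longrightarrow> W n k = 0"
  by (simp_all add: V_def W_def subs_empty)

text \<open>The assumptions make \<open>e\<close> compatible with \<open>d\<close>: dropping from
  above \<open>*\<close> to not above it is a descent, and rising is none. The recurrences of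
  \<open>V\<close> and \<open>W\<close> are coupled, so both forms are proved at once;
  \<open>W\<close> is shifted to \<open>Suc k\<close> so that both contain
  \<open>gbin n k t\<close>. The bound \<open>p\<close> limits compatibility to the first
  \<open>p\<close> letters, and the induction hypothesis is only used for words that are no
  longer.\<close>

lemma V_W_closed_form:
  assumes "\<And>i. 1 \<le> i \<Longrightarrow> Suc i \<le> p \<Longrightarrow> e i \<Longrightarrow> \<not> e (Suc i) \<Longrightarrow> d i"
    and "\<And>i. 1 \<le> i \<Longrightarrow> Suc i \<le> p \<Longrightarrow> \<not> e i \<Longrightarrow> e (Suc i) \<Longrightarrow> \<not> d i"
  shows "(Suc n - k \<le> p \<longrightarrow> V (Suc n) k = t ^ (smaj d (Suc n - k) + (if e (Suc n - k) then 0 else k)) * gbin n k t)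
       \<and> (n - k \<le> p \<longrightarrow> W (Suc n) (Suc k) = t ^ (smaj d (n - k) + (if e (n - k) then n - k else 0)) * gbin n k t)"
proof (induction n arbitrary: k)
  case 0
  have "{S. S \<in> subs 0 0 \<and> 0 \<notin> S} = {{}}" by (auto simp: subs_0)
  then have V0: "V 0 0 = 1" by (simp add: V_def)
  show ?case
  proof (cases k)
    case 0
    then show ?thesis using V0 W_0[of 0] V_Suc[of 0 0] W_Suc[of 0 0] by (simp add: smaj_Suc)
  next
    case (Suc j)
    show ?thesis
      using V_W_eq_0[of "Suc 0" "Suc k"] V_W_eq_0[of 0 k] V_W_eq_0[of "Suc 0" k] W_Suc[of 0 k]
      by (cases j) (simp_all add: Suc V_def[of "Suc 0"] subs_Suc_notin subs_empty)
  qed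
next
  case (Suc n)
  show ?case
  proof (intro conjI impI)
    assume p: "Suc (Suc n) - k \<le> p"
    show "V (Suc (Suc n)) k = t ^ (smaj d (Suc (Suc n) - k) + (if e (Suc (Suc n) - k) then 0 else k)) * gbin (Suc n) k t"
    proof (cases k)
      case 0
      have "V (Suc n) 0 = t ^ smaj d (Suc n)"
        using Suc[of 0] p 0 by simp
      then show ?thesis
        using 0 V_Suc[of 0 "Suc n"] by (simp add: W_0 smaj_Suc[of d "Suc n"] power_add mult.commute)
    next
      case k: (Suc j)
      show ?thesis
      proof (cases "j \<le> n")
        case False
        then show ?thesis
          using k by (simp add: V_def subs_Suc_notin subs_empty gbin_eq_0 del: gbin.simps)
      next
        case True
        then obtain r where n: "n = j + r" using le_Suc_ex by blast
        have W: "W (Suc n) k = t ^ (smaj d r + (if e r then r else 0)) * gbin n j t"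
          using Suc[of j] p k n by simp
        have V: "V (Suc n) k = t ^ (smaj d r + (if e r then 0 else k)) * gbin n k t"
          using Suc[of k] p k n by simp
        have rec: "V (Suc (Suc n)) k = t ^ (if d r then Suc n else 0) * V (Suc n) k
                     + t ^ (if e (Suc r) then 0 else Suc n) * W (Suc n) k"
          using V_Suc[of k "Suc n"] k n by simp
        have P1: "gbin (Suc n) k t = gbin n j t + t ^ k * gbin n k t"
          using k by simp
        have P2: "gbin (Suc n) k t = t ^ r * gbin n j t + gbin n k t"
          using k n gbin_Suc_Suc'[of j n t] by simp
        have goal: "Suc (Suc n) - k = Suc r" "Suc n = k + r" using k n by simp_all
        show ?thesis
        \<comment> \<open>For \<open>r = 0\<close> no letter precedes the last one, and
          \<open>d 0\<close> and \<open>e 0\<close> mean nothing. They do no harm: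
          \<open>gbin n k t\<close> vanishes and the exponent attached to \<open>e r\<close> in
          \<open>W\<close> is 0.\<close>
        proof (cases "r = 0")
          case True
          then have "gbin n k t = 0" using k n by (simp add: gbin_eq_0)
          then show ?thesis
            unfolding rec V W goal(1) P1 smaj_Suc using True k n by simp
        next
          case False
          then have c: "e r \<Longrightarrow> \<not> e (Suc r) \<Longrightarrow> d r" "\<not> e r \<Longrightarrow> e (Suc r) \<Longrightarrow> \<not> d r"
            using assms[of r] p goal by auto
          \<comment> \<open>Compatibility rules out two of the eight combinations. In each of the
            others the powers of \<open>t\<close> match one of the two Pascal rules.\<close>
          consider "d r" "e r" "e (Suc r)" | "\<not> d r" "e r" "e (Suc r)" | "d r" "e r" "\<not> e (Suc r)"
            | "\<not> d r" "\<not> e r" "e (Suc r)" | "d r" "\<not> e r" "\<not> e (Suc r)" | "\<not> d r" "\<not> e r" "\<not> e (Suc r)"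
            using c by metis
          then show ?thesis
          proof cases
            case 1 then show ?thesis
              unfolding rec V W goal(1) P1 smaj_Suc unfolding goal(2) by (simp add: power_add algebra_simps)
          next
            case 2 then show ?thesis
              unfolding rec V W goal(1) P2 smaj_Suc unfolding goal(2) by (simp add: power_add algebra_simps)
          next
            case 3 then show ?thesis
              unfolding rec V W goal(1) P2 smaj_Suc unfolding goal(2) by (simp add: power_add algebra_simps)
          next
            case 4 then show ?thesis
              unfolding rec V W goal(1) P1 smaj_Suc unfolding goal(2) by (simp add: power_add algebra_simps)
          next
            case 5 then show ?thesis
              unfolding rec V W goal(1) P1 smaj_Suc unfolding goal(2) by (simp add: power_add algebra_simps)
          next
            case 6 then show ?thesis
              unfolding rec V W goal(1) P2 smaj_Suc unfolding goal(2) by (simp add: power_add algebra_simps)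
          qed
        qed
      qed
    qed
  next
    assume p: "Suc n - k \<le> p"
    have rec: "W (Suc (Suc n)) (Suc k) = W (Suc n) k + t ^ (if e (Suc n - k) then Suc n else 0) * V (Suc n) k"
      by (rule W_Suc)
    have V: "V (Suc n) k = t ^ (smaj d (Suc n - k) + (if e (Suc n - k) then 0 else k)) * gbin n k t"
      using Suc[of k] p by simp
    show "W (Suc (Suc n)) (Suc k) = t ^ (smaj d (Suc n - k) + (if e (Suc n - k) then Suc n - k else 0)) * gbin (Suc n) k t"
    proof (cases k)
      case 0
      then show ?thesis unfolding rec V by (simp add: W_0 power_add mult.commute)
    next
      case k: (Suc j)
      show ?thesis
      proof (cases "j \<le> n")
        case False
        then show ?thesis
          using k V_W_eq_0(2)[of "Suc (Suc n)" "Suc k"] by (simp add: gbin_eq_0 del: gbin.simps)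
      next
        case True
        then obtain r where n: "n = j + r" using le_Suc_ex by blast
        have W: "W (Suc n) k = t ^ (smaj d r + (if e r then r else 0)) * gbin n j t"
          using Suc[of j] p k n by simp
        have P1: "gbin (Suc n) k t = gbin n j t + t ^ k * gbin n k t"
          using k by simp
        have goal: "Suc n - k = r" "Suc n = k + r" using k n by simp_all
        show ?thesis
          unfolding rec V W goal(1) P1 unfolding goal(2) by (simp add: power_add algebra_simps)
      qed
    qed
  qed
qed

text \<open>The dependence on \<open>e\<close> cancels: by the closed forms \<open>V + W\<close> is
  one of the two Pascal rules, selected by \<open>e (n - k)\<close>.\<close>

lemma sum_mask_maj:
  assumes "\<And>i. 1 \<le> i \<Longrightarrow> Suc i \<le> n - k \<Longrightarrow> e i \<Longrightarrow> \<not> e (Suc i) \<Longrightarrow> d i"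
    and "\<And>i. 1 \<le> i \<Longrightarrow> Suc i \<le> n - k \<Longrightarrow> \<not> e i \<Longrightarrow> e (Suc i) \<Longrightarrow> \<not> d i"
  shows "(\<Sum>S\<in>subs n k. t ^ smaj (mask_des d e S) n) = t ^ smaj d (n - k) * gbin n k t"
proof (cases n)
  case 0
  then show ?thesis by (cases k) (simp_all add: subs_0 subs_empty)
next
  case n: (Suc N)
  have cf: "(Suc N - k' \<le> n - k \<longrightarrow> V (Suc N) k' = t ^ (smaj d (Suc N - k') + (if e (Suc N - k') then 0 else k')) * gbin N k' t)
       \<and> (N - k' \<le> n - k \<longrightarrow> W (Suc N) (Suc k') = t ^ (smaj d (N - k') + (if e (N - k') then N - k' else 0)) * gbin N k' t)" for k'
    using assms by (intro V_W_closed_form)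
  have V: "V n k = t ^ (smaj d (n - k) + (if e (n - k) then 0 else k)) * gbin N k t"
    using cf[of k] n by simp
  show ?thesis
  proof (cases k)
    case 0
    then show ?thesis using V by (simp add: W_add_V[symmetric] W_0)
  next
    case k: (Suc j)
    have W: "W n k = t ^ (smaj d (n - k) + (if e (n - k) then n - k else 0)) * gbin N j t"
      using cf[of j] n k by simp
    show ?thesis
    proof (cases "j \<le> N")
      case True
      have P1: "gbin n k t = gbin N j t + t ^ k * gbin N k t"
        using k n by simp
      have P2: "gbin n k t = t ^ (n - k) * gbin N j t + gbin N k t"
        using k n gbin_Suc_Suc'[OF True, of t] by simp
      show ?thesis
      proof (cases "e (n - k)")
        case True
        then show ?thesis
          unfolding W_add_V[symmetric] V W P2 by (simp add: power_add algebra_simps)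
      next
        case False
        then show ?thesis
          unfolding W_add_V[symmetric] V W P1 by (simp add: power_add algebra_simps)
      qed
    next
      case False
      then show ?thesis using k n by (simp add: subs_empty gbin_eq_0 del: gbin.simps)
    qed
  qed
qed

end

text \<open>If \<open>i\<close> is the \<open>j\<close>-th element of \<open>S\<close>, then \<open>i - j = rnk S i\<close>; so \<open>shift\<close> is the second term of \<open>maf\<close>.\<close>

definition shift :: "nat set \<Rightarrow> nat" where
  "shift S = (\<Sum>i\<in>S. rnk S i)"

text \<open>The positions \<open>1..a\<close> lie outside \<open>S\<close> and add \<open>a\<close>
  to the rank of each of the \<open>k\<close> elements; what is left is the classical count of
  \<open>k\<close>-subsets of an \<open>(n - a)\<close>-set. The induction splits on whether the
  largest position belongs to \<open>S\<close> and ends in the mirrored Pascal rule.\<close>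

lemma sum_shift_subs:
  fixes t :: "'a::comm_ring_1"
  assumes "a \<le> n"
  shows "(\<Sum>S | S \<in> subs n k \<and> S \<subseteq> {a<..}. t ^ shift S) = t ^ (a * k) * gbin (n - a) k t"
  using assms
proof (induction n arbitrary: k rule: dec_induct)
  case base
  show ?case
  proof (cases k)
    case 0
    have "{S. S \<in> subs a k \<and> S \<subseteq> {a<..}} = {{}}" using 0 by (auto simp: subs_0)
    then show ?thesis using 0 by (simp add: shift_def)
  next
    case (Suc j)
    have "{S. S \<in> subs a k \<and> S \<subseteq> {a<..}} = {}"
    proof -
      have False if "S \<in> subs a k" "S \<subseteq> {a<..}" for S
      proof -
        have "S = {}" using that by (fastforce simp: subs_def)
        with that Suc show False by (simp add: subs_def)
      qed
      then show ?thesis by blast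
    qed
    then show ?thesis using Suc by (simp only: sum.empty) simp
  qed
next
  case (step n)
  show ?case
  proof (cases k)
    case 0
    have "{S. S \<in> subs (Suc n) k \<and> S \<subseteq> {a<..}} = {{}}" using 0 by (auto simp: subs_0)
    then show ?thesis using 0 by (simp add: shift_def)
  next
    case k: (Suc j)
    let ?f = "\<lambda>S. if S \<subseteq> {a<..} then t ^ shift S else 0"
    have filt: "(\<Sum>S | S \<in> subs n k \<and> S \<subseteq> {a<..}. t ^ shift S) = sum ?f (subs n k)" for n k
      by (simp add: sum.inter_filter)
    have ins: "?f (insert (Suc n) S) = t ^ (n - j) * ?f S" if S: "S \<in> subs n j" for S
    proof -
      have fin: "finite S" "Suc n \<notin> S" using S by (auto simp: subs_def intro: finite_subset)
      have "rnk (insert (Suc n) S) (Suc n) = rnk S n"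
        unfolding rnk_def by (rule arg_cong[where f = card]) (auto simp: atLeastAtMostSuc_conv)
      also have "\<dots> = n - j" by (rule rnk_subs(1)[OF S])
      finally have "shift (insert (Suc n) S) = (n - j) + (\<Sum>i\<in>S. rnk (insert (Suc n) S) i)"
        unfolding shift_def using fin by simp
      also have "(\<Sum>i\<in>S. rnk (insert (Suc n) S) i) = shift S"
        unfolding shift_def by (rule sum.cong) (use S in \<open>auto simp: subs_def intro!: rnk_insert_Suc\<close>)
      finally show ?thesis using step.hyps by (simp add: power_add)
    qed
    have "sum ?f (subs (Suc n) k) = t ^ (n - j) * sum ?f (subs n j) + sum ?f (subs n k)"
      unfolding k sum_subs_Suc sum_distrib_left using ins by simp
    also have "\<dots> = t ^ (n - j) * (t ^ (a * j) * gbin (n - a) j t) + t ^ (a * k) * gbin (n - a) k t"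
      using step.IH[of j] step.IH[of k] unfolding filt by simp
    also have "\<dots> = t ^ (a * k) * gbin (Suc n - a) k t"
    proof (cases "j \<le> n - a")
      case True
      define r where "r = n - a - j"
      then have r: "n = a + j + r"
        using step.hyps True by simp
      have "gbin (Suc n - a) k t = t ^ r * gbin (n - a) j t + gbin (n - a) k t"
        using gbin_Suc_Suc'[OF True, of t] by (simp add: k r)
      then show ?thesis
        using r by (simp add: k power_add distrib_left mult_ac)
    next
      case False
      then show ?thesis
        using k step.hyps by (simp add: gbin_eq_0 Suc_diff_le del: gbin.simps)
    qed
    finally show ?thesis unfolding filt .
  qed
qed

section \<open>The flag major index on coloured permutations\<close>

lemma colpermsI:
  assumes "length w = n" "\<And>p. p \<in> set w \<Longrightarrow> fst p < l" "snd ` set w = {1..n}"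
  shows "w \<in> colperms l n"
proof -
  have "distinct (map snd w)"
    by (rule card_distinct) (use assms in simp)
  with assms show ?thesis by (auto simp: colperms_def)
qed

lemma colpermsD:
  assumes "w \<in> colperms l n"
  shows "length w = n" "p \<in> set w \<Longrightarrow> fst p < l" "snd ` set w = {1..n}" "distinct (map snd w)"
  using assms by (auto simp: colperms_def)

lemma finite_colperms [simp]: "finite (colperms l n)"
proof (rule finite_subset)
  show "colperms l n \<subseteq> {w. set w \<subseteq> {..<l} \<times> {1..n} \<and> length w = n}"
  proof
    fix w assume "w \<in> colperms l n"
    note D = colpermsD[OF this]
    have "p \<in> {..<l} \<times> {1..n}" if "p \<in> set w" for p
      using D(2)[OF that] D(3) that by (auto simp: mem_Times_iff)
    then show "w \<in> {w. set w \<subseteq> {..<l} \<times> {1..n} \<and> length w = n}"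
      using D(1) by blast
  qed
qed (rule finite_lists_length_eq, simp)

lemma maj_eq_smaj: "maj w = smaj (\<lambda>i. sig_less (w ! i) (w ! (i - 1))) (length w)"
  by (simp add: maj_def smaj_def)

section \<open>Insertion of one letter and the product formula\<close>

definition insert_letter :: "nat \<Rightarrow> nat \<times> nat \<Rightarrow> (nat \<times> nat) list \<Rightarrow> (nat \<times> nat) list" where
  "insert_letter i a w = take i w @ a # drop i w"

lemma rnk_singleton: "1 \<le> r \<Longrightarrow> rnk {Suc i} r = (if r \<le> i then r else r - 1)"
  unfolding rnk_def by (cases "r \<le> i") (simp_all add: card_Diff_singleton_if)

text \<open>The inserted letter plays the part of \<open>*\<close>. List index \<open>i\<close> is
  position \<open>Suc i\<close>, hence the mask \<open>{Suc i}\<close>.\<close>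

lemma maj_insert_letter:
  assumes "i \<le> length w" "\<And>p. p \<in> set w \<Longrightarrow> snd p \<noteq> snd a"
  shows "maj (insert_letter i a w) =
    smaj (mask_des (\<lambda>r. sig_less (w ! r) (w ! (r - 1))) (\<lambda>r. sig_less a (w ! (r - 1))) {Suc i})
      (Suc (length w))"
proof -
  let ?w = "insert_letter i a w"
  have len: "length ?w = Suc (length w)" using assms(1) by (simp add: insert_letter_def)
  have nth: "?w ! p = (if p < i then w ! p else if p = i then a else w ! (p - 1))" for p
    using assms(1) by (simp add: insert_letter_def nth_append nth_Cons')
  show ?thesis
    unfolding maj_eq_smaj len
  proof (rule smaj_cong)
    fix r assume r: "1 \<le> r" "r < Suc (length w)"
    consider "r < i" | "r = i" | "r = Suc i" | "Suc i < r" by linarith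
    then show "sig_less (?w ! r) (?w ! (r - 1)) =
      mask_des (\<lambda>r. sig_less (w ! r) (w ! (r - 1))) (\<lambda>r. sig_less a (w ! (r - 1))) {Suc i} r"
    proof cases
      \<comment> \<open>Just after \<open>*\<close> the mask uses a negated comparison; this is
        correct because distinct absolute values exclude equality.\<close>
      case 3
      then have "snd (w ! i) \<noteq> snd a" using r assms(2)[of "w ! i"] by simp
      then have "sig_less (w ! i) a \<longleftrightarrow> \<not> sig_less a (w ! i)"
        by (auto simp: sig_less_def)
      with 3 show ?thesis by (simp add: nth mask_des_def rnk_singleton)
    qed (use r in \<open>auto simp: nth mask_des_def rnk_singleton\<close>)
  qed
qed

text \<open>The shuffle theorem with one \<open>*\<close>. Its compatibility assumptions hold
  because \<open>sig_less\<close> is a strict linear order.\<close>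

lemma sum_maj_insert_letter:
  fixes t :: "'a::comm_ring_1"
  assumes "\<And>p. p \<in> set w \<Longrightarrow> snd p \<noteq> snd a"
  shows "(\<Sum>i\<le>length w. t ^ maj (insert_letter i a w)) = t ^ maj w * qint (Suc (length w)) t"
proof -
  let ?n = "length w"
  let ?d = "\<lambda>r. sig_less (w ! r) (w ! (r - 1))" and ?e = "\<lambda>r. sig_less a (w ! (r - 1))"
  have subs: "subs (Suc ?n) (Suc 0) = (\<lambda>i. {Suc i}) ` {..?n}"
  proof (intro set_eqI iffI)
    fix S assume "S \<in> subs (Suc ?n) (Suc 0)"
    then obtain s where "S = {s}" "s \<in> {1..Suc ?n}"
      by (auto simp: subs_def card_1_singleton_iff)
    then show "S \<in> (\<lambda>i. {Suc i}) ` {..?n}"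
      by (intro image_eqI[of _ _ "s - 1"]) auto
  qed (auto simp: subs_def)
  have "(\<Sum>i\<le>?n. t ^ maj (insert_letter i a w))
      = (\<Sum>i\<le>?n. t ^ smaj (mask_des ?d ?e {Suc i}) (Suc ?n))"
    by (rule sum.cong) (use assms in \<open>simp_all add: maj_insert_letter\<close>)
  also have "\<dots> = (\<Sum>S\<in>subs (Suc ?n) (Suc 0). t ^ smaj (mask_des ?d ?e S) (Suc ?n))"
    unfolding subs by (subst sum.reindex) (auto simp: inj_on_def)
  also have "\<dots> = t ^ smaj ?d ?n * qint (Suc ?n) t"
    by (subst sum_mask_maj) (use assms in \<open>force simp: sig_less_def gbin_one\<close>)+
  finally show ?thesis by (simp add: maj_eq_smaj)
qed

text \<open>Insertion of the letter with absolute value \<open>Suc n\<close> is undone by deleting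
  it and recording its colour and its index \<open>idx w\<close>.\<close>

lemma sum_colperms_Suc:
  fixes F :: "(nat \<times> nat) list \<Rightarrow> 'a::comm_ring_1"
  shows "(\<Sum>w\<in>colperms l (Suc n). F w)
    = (\<Sum>(w, j, i)\<in>colperms l n \<times> {..<l} \<times> {..n}. F (insert_letter i (j, Suc n) w))"
proof -
  let ?P = "\<lambda>p. snd p \<noteq> Suc n"
  define idx where "idx w = length (takeWhile ?P w)" for w :: "(nat \<times> nat) list"
  show ?thesis
  proof (rule sum.reindex_bij_witness[where
        j = "\<lambda>w. (filter ?P w, fst (w ! idx w), idx w)" and
        i = "\<lambda>(w, j, i). insert_letter i (j, Suc n) w"])
    fix w assume w: "w \<in> colperms l (Suc n)"
    note D = colpermsD[OF w]
    have "Suc n \<in> snd ` set w" using D(3) by simp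
    then obtain j where "(j, Suc n) \<in> set w" by auto
    then obtain us vs where split: "w = us @ (j, Suc n) # vs" by (meson split_list)
    have us: "?P p" if "p \<in> set us" for p using D(4) that unfolding split by force
    have vs: "?P p" if "p \<in> set vs" for p using D(4) that unfolding split by force
    have tw: "takeWhile ?P w = us" unfolding split using us by (simp add: takeWhile_append)
    have flt: "filter ?P w = us @ vs" unfolding split using us vs by simp
    have eq: "insert_letter (idx w) (fst (w ! idx w), Suc n) (filter ?P w) = w"
      unfolding idx_def tw flt by (simp add: split insert_letter_def)
    then show "(case (filter ?P w, fst (w ! idx w), idx w) of (w, j, i) \<Rightarrow> insert_letter i (j, Suc n) w) = w"
      "(case (filter ?P w, fst (w ! idx w), idx w) of (w, j, i) \<Rightarrow> F (insert_letter i (j, Suc n) w)) = F w"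
      by simp_all
    have "snd ` set (filter ?P w) = snd ` set w - {Suc n}" by auto
    also have "\<dots> = {1..n}" unfolding D(3) by auto
    finally have "filter ?P w \<in> colperms l n"
      using D(1,2) by (intro colpermsI) (simp_all add: flt, auto simp: split)
    moreover have "idx w \<le> n" using D(1) unfolding idx_def tw by (simp add: split)
    moreover have "fst (w ! idx w) < l" using D(2)[of "(j, Suc n)"] unfolding idx_def tw by (simp add: split)
    ultimately show "(filter ?P w, fst (w ! idx w), idx w) \<in> colperms l n \<times> {..<l} \<times> {..n}" by simp
  next
    fix x assume "x \<in> colperms l n \<times> {..<l} \<times> {..n}"
    then obtain w j i where x: "x = (w, j, i)" "w \<in> colperms l n" "j < l" "i \<le> n" by auto
    note D = colpermsD[OF x(2)]
    have P: "?P p" if "p \<in> set w" for p using D(3) that by force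
    have tw: "takeWhile ?P (insert_letter i (j, Suc n) w) = take i w"
      unfolding insert_letter_def using P by (subst takeWhile_append2) (auto dest: in_set_takeD)
    have idx: "idx (insert_letter i (j, Suc n) w) = i"
      unfolding idx_def tw using D(1) x by simp
    have flt: "filter ?P (insert_letter i (j, Suc n) w) = w"
    proof -
      have "filter ?P w = w" using P by (simp add: filter_id_conv)
      moreover have "filter ?P w = filter ?P (take i w) @ filter ?P (drop i w)"
        by (metis append_take_drop_id filter_append)
      ultimately show ?thesis
        unfolding insert_letter_def by simp
    qed
    have nth: "insert_letter i (j, Suc n) w ! i = (j, Suc n)"
      using D(1) x by (simp add: insert_letter_def nth_append)
    show "(filter ?P (case x of (w, j, i) \<Rightarrow> insert_letter i (j, Suc n) w),
           fst ((case x of (w, j, i) \<Rightarrow> insert_letter i (j, Suc n) w) ! idx (case x of (w, j, i) \<Rightarrow> insert_letter i (j, Suc n) w)),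
           idx (case x of (w, j, i) \<Rightarrow> insert_letter i (j, Suc n) w)) = x"
      by (simp add: x(1) idx flt nth)
    have set: "set (insert_letter i (j, Suc n) w) = insert (j, Suc n) (set w)"
      unfolding insert_letter_def by simp (metis append_take_drop_id set_append)
    have "insert_letter i (j, Suc n) w \<in> colperms l (Suc n)"
    proof (rule colpermsI)
      show "length (insert_letter i (j, Suc n) w) = Suc n" using D(1) x by (simp add: insert_letter_def)
      show "snd ` set (insert_letter i (j, Suc n) w) = {1..Suc n}"
        unfolding set using D(3) by (simp add: atLeastAtMostSuc_conv)
    qed (use D(2) x in \<open>auto simp: set\<close>)
    then show "(case x of (w, j, i) \<Rightarrow> insert_letter i (j, Suc n) w) \<in> colperms l (Suc n)"
      by (simp add: x(1))
  qed
qed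

lemma col_insert_letter: "col (insert_letter i a w) = fst a + col w"
proof -
  have "col w = col (take i w) + col (drop i w)"
    unfolding col_def by (metis append_take_drop_id map_append sum_list_append)
  then show ?thesis by (simp add: insert_letter_def col_def)
qed

text \<open>Inserting the new letter in colour \<open>j\<close> contributes
  \<open>q ^ j * qint (Suc n) (q ^ l)\<close>; summing over the colours gives
  \<open>qint l q * qint (Suc n) (q ^ l)\<close>, which is
  \<open>qint (Suc n * l) q\<close>.\<close>

lemma sum_fmaj_colperms:
  fixes q :: "'a::comm_ring_1"
  shows "(\<Sum>w\<in>colperms l n. (q ^ l) ^ maj w * q ^ col w) = (\<Prod>i\<in>{1..n}. qint (i * l) q)"
proof (induction n)
  case 0
  have "colperms l 0 = {[]}" by (auto simp: colperms_def)
  then show ?case by (simp add: maj_def col_def)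
next
  case (Suc n)
  have "(\<Sum>w\<in>colperms l (Suc n). (q ^ l) ^ maj w * q ^ col w)
      = (\<Sum>w\<in>colperms l n. \<Sum>j<l. \<Sum>i\<le>n.
          (q ^ l) ^ maj (insert_letter i (j, Suc n) w) * q ^ col (insert_letter i (j, Suc n) w))"
    unfolding sum_colperms_Suc by (simp add: sum.cartesian_product)
  also have "\<dots> = (\<Sum>w\<in>colperms l n. \<Sum>j<l. q ^ j * (qint (Suc n) (q ^ l) * ((q ^ l) ^ maj w * q ^ col w)))"
  proof (intro sum.cong refl)
    fix w j assume w: "w \<in> colperms l n"
    have "snd p \<noteq> Suc n" if "p \<in> set w" for p using colpermsD(3)[OF w] that by force
    then have "(\<Sum>i\<le>n. (q ^ l) ^ maj (insert_letter i (j, Suc n) w)) = (q ^ l) ^ maj w * qint (Suc n) (q ^ l)"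
      using sum_maj_insert_letter[of w "(j, Suc n)" "q ^ l"] colpermsD(1)[OF w] by simp
    then show "(\<Sum>i\<le>n. (q ^ l) ^ maj (insert_letter i (j, Suc n) w) * q ^ col (insert_letter i (j, Suc n) w))
        = q ^ j * (qint (Suc n) (q ^ l) * ((q ^ l) ^ maj w * q ^ col w))"
      unfolding col_insert_letter power_add fst_conv sum_distrib_right[symmetric] by (simp add: mult_ac)
  qed
  also have "\<dots> = qint (Suc n * l) q * (\<Sum>w\<in>colperms l n. (q ^ l) ^ maj w * q ^ col w)"
    unfolding qint_mult sum_distrib_right[symmetric] sum_distrib_left[symmetric] qint_def[of l q]
    by (simp only: mult_ac)
  finally show ?case
    unfolding Suc.IH by (simp add: mult.commute)
qed

section \<open>Decomposition into fixed points and derangement part\<close>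

definition nonfix :: "nat set \<Rightarrow> nat \<Rightarrow> nat list" where
  "nonfix S n = filter (\<lambda>i. i \<notin> S) [1..<Suc n]"

lemma set_nonfix: "set (nonfix S n) = {1..n} - S"
  by (auto simp: nonfix_def)

lemma distinct_nonfix: "distinct (nonfix S n)"
  by (simp add: nonfix_def)

lemma rnk_Suc: "rnk S (Suc i) = rnk S i + (if Suc i \<in> S then 0 else 1)"
proof -
  have "{1..Suc i} - S = (if Suc i \<in> S then {1..i} - S else insert (Suc i) ({1..i} - S))"
    by (auto simp: atLeastAtMostSuc_conv)
  then show ?thesis by (simp add: rnk_def)
qed

lemma rnk_0 [simp]: "rnk S 0 = 0"
  by (simp add: rnk_def)

lemma length_nonfix: "length (nonfix S n) = rnk S n"
  unfolding rnk_def set_nonfix[symmetric] by (rule distinct_card[symmetric]) (rule distinct_nonfix)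

lemma rnk_mono: "i \<le> j \<Longrightarrow> rnk S i \<le> rnk S j"
  by (rule lift_Suc_mono_le) (simp_all add: rnk_Suc)

lemma rnk_less:
  assumes "j \<notin> S" "i < j"
  shows "rnk S i < rnk S j"
proof -
  obtain k where k: "j = Suc k" using assms by (cases j) auto
  then have "rnk S i \<le> rnk S k" using assms by (intro rnk_mono) simp
  then show ?thesis using assms k by (simp add: rnk_Suc)
qed

lemma rnk_less_iff:
  assumes "i \<notin> S" "j \<notin> S"
  shows "rnk S i < rnk S j \<longleftrightarrow> i < j"
  using rnk_less[of i S j] rnk_less[of j S i] assms by (metis less_irrefl linorder_neqE_nat less_asym)

lemma rnk_eq_iff:
  assumes "i \<notin> S" "j \<notin> S"
  shows "rnk S i = rnk S j \<longleftrightarrow> i = j"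
  using rnk_less[of i S j] rnk_less[of j S i] assms by (metis less_irrefl linorder_neqE_nat)

text \<open>With \<open>rnk_nonfix_nth\<close>, this makes \<open>nonfix S n\<close> and
  \<open>rnk S\<close> inverse to each other; the \<open>- 1\<close> converts ranks, which start at
  1, to list indices.\<close>

lemma nonfix_nth_rnk:
  assumes "i \<in> {1..n} - S"
  shows "nonfix S n ! (rnk S i - 1) = i"
  using assms
proof (induction n)
  case (Suc n)
  have *: "nonfix S (Suc n) = nonfix S n @ (if Suc n \<in> S then [] else [Suc n])"
    by (simp add: nonfix_def)
  show ?case
  proof (cases "i = Suc n")
    case True
    then show ?thesis using Suc.prems by (simp add: * nth_append length_nonfix rnk_Suc)
  next
    case False
    then have i: "i \<in> {1..n} - S" using Suc.prems by auto
    have "rnk S 0 < rnk S i" using i by (intro rnk_less) auto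
    moreover have "rnk S i \<le> rnk S n" using i by (intro rnk_mono) simp
    ultimately have "rnk S i - 1 < length (nonfix S n)" by (simp add: length_nonfix)
    then show ?thesis using Suc.IH[OF i] by (simp add: * nth_append)
  qed
qed simp

lemma rnk_pos: "i \<in> {1..n} - S \<Longrightarrow> 1 \<le> rnk S i \<and> rnk S i \<le> rnk S n"
  using rnk_less[of i S 0] rnk_mono[of i n S] by auto

lemma rnk_nonfix_nth:
  assumes "j < rnk S n"
  shows "rnk S (nonfix S n ! j) = Suc j"
proof -
  let ?i = "nonfix S n ! j"
  have i: "?i \<in> {1..n} - S"
    using assms nth_mem[of j "nonfix S n"] by (simp add: length_nonfix set_nonfix)
  have r: "1 \<le> rnk S ?i" "rnk S ?i \<le> rnk S n" using rnk_pos[OF i] by auto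
  have "nonfix S n ! (rnk S ?i - 1) = nonfix S n ! j" using nonfix_nth_rnk[OF i] .
  then have "rnk S ?i - 1 = j"
    using assms r distinct_nonfix[of S n]
    by (subst (asm) nth_eq_iff_index_eq) (simp_all add: length_nonfix)
  then show ?thesis using r by simp
qed

lemma nonfix_nth_mem: "j < rnk S n \<Longrightarrow> nonfix S n ! j \<in> {1..n} - S"
  using nth_mem[of j "nonfix S n"] by (simp add: length_nonfix set_nonfix)

lemma rnk_image: "rnk S ` ({1..n} - S) = {1..rnk S n}"
proof (intro subset_antisym subsetI)
  fix j assume "j \<in> rnk S ` ({1..n} - S)"
  then show "j \<in> {1..rnk S n}" using rnk_pos by force
next
  fix j assume j: "j \<in> {1..rnk S n}"
  then have "j - 1 < rnk S n" by auto
  from rnk_nonfix_nth[OF this] nonfix_nth_mem[OF this] j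
  show "j \<in> rnk S ` ({1..n} - S)" by (intro image_eqI[of _ _ "nonfix S n ! (j - 1)"]) auto
qed

text \<open>The inverse of \<open>Der\<close> on permutations with fixed point set \<open>S\<close>:
  both positions and absolute values are relabelled from ranks back to elements outside
  \<open>S\<close>.\<close>

definition expand :: "nat set \<Rightarrow> nat \<Rightarrow> (nat \<times> nat) list \<Rightarrow> (nat \<times> nat) list" where
  "expand S n u = map (\<lambda>i. if i \<in> S then (0, i)
      else (fst (u ! (rnk S i - 1)), nonfix S n ! (snd (u ! (rnk S i - 1)) - 1))) [1..<Suc n]"

abbreviation fixset_perms :: "nat \<Rightarrow> nat \<Rightarrow> nat set \<Rightarrow> (nat \<times> nat) list set" where
  "fixset_perms l n S \<equiv> {w \<in> colperms l n. FIX w = S}"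

lemma nth_image_set: "length w = n \<Longrightarrow> set w = (\<lambda>i. w ! (i - 1)) ` {1..n}"
proof -
  assume len: "length w = n"
  have "set w = (!) w ` {..<n}" using len by (auto simp: in_set_conv_nth)
  also have "{..<n} = (\<lambda>i. i - 1) ` {1..n}"
    by (auto intro!: image_eqI[of _ _ "Suc _"])
  finally show ?thesis by (simp add: image_image)
qed

section \<open>From a coloured permutation to its derangement part\<close>

context
  fixes l n S w
  assumes w: "w \<in> fixset_perms l n S"
begin

private lemma len: "length w = n" and FIX: "FIX w = S"
  using w colpermsD(1) by auto

private lemma S_subset: "S \<subseteq> {1..n}"
  using FIX len by (auto simp: FIX_def)

lemma letter_fixed: "i \<in> S \<Longrightarrow> w ! (i - 1) = (0, i)"
  using FIX by (auto simp: FIX_def)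

lemma letter_not_fixed: "i \<in> {1..n} - S \<Longrightarrow> w ! (i - 1) \<noteq> (0, i)"
  using FIX len by (auto simp: FIX_def)

private abbreviation "p \<equiv> (\<lambda>i. snd (w ! (i - 1)))"

private lemma p_inj: "inj_on p {1..n}"
proof -
  have "card (p ` {1..n}) = card {1..n}"
    using w colpermsD(3)[of w l n] nth_image_set[OF len] by (simp add: image_image)
  then show ?thesis by (simp add: eq_card_imp_inj_on)
qed

text \<open>Absolute values permute \<open>{1..n}\<close> and fix each element of \<open>S\<close>,
  hence they permute the complement. So the rank used in \<open>Der\<close> for values is the same
  function \<open>rnk S\<close> that renumbers positions.\<close>

private lemma p_nonfixed: "p ` ({1..n} - S) = {1..n} - S"
proof -
  have "p ` ({1..n} - S) = p ` {1..n} - p ` S"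
    by (rule inj_on_image_set_diff[OF p_inj]) (use S_subset in auto)
  also have "p ` {1..n} = {1..n}"
    using w colpermsD(3)[of w l n] nth_image_set[OF len] by (simp add: image_image)
  also have "p ` S = S" using letter_fixed by force
  finally show ?thesis .
qed

lemma Der_eq: "Der w = map (\<lambda>i. (fst (w ! (i - 1)), rnk S (p i))) (nonfix S n)"
proof -
  have A: "set (map snd (map (\<lambda>i. w ! (i - 1)) (nonfix S n))) = {1..n} - S"
    using p_nonfixed by (simp add: image_image set_nonfix)
  have rank: "card {a \<in> {1..n} - S. a \<le> p i} = rnk S (p i)" if "i \<in> {1..n} - S" for i
  proof -
    have "p i \<in> {1..n} - S" using p_nonfixed that by blast
    then have "{a \<in> {1..n} - S. a \<le> p i} = {1..p i} - S" by auto
    then show ?thesis by (simp add: rnk_def)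
  qed
  have "Der w = map (\<lambda>(j, k). (j, card {a \<in> {1..n} - S. a \<le> k})) (map (\<lambda>i. w ! (i - 1)) (nonfix S n))"
    unfolding Der_def Let_def FIX len using A by (simp add: nonfix_def)
  then show ?thesis
    using rank by (simp add: set_nonfix case_prod_beta)
qed

lemma length_Der: "length (Der w) = rnk S n"
  by (simp add: Der_eq length_nonfix)

lemma Der_nth:
  assumes "i \<in> {1..n} - S"
  shows "Der w ! (rnk S i - 1) = (fst (w ! (i - 1)), rnk S (p i))"
proof -
  have "rnk S i - 1 < length (nonfix S n)" using rnk_pos[OF assms] by (auto simp: length_nonfix)
  then show ?thesis unfolding Der_eq by (simp only: nth_map nonfix_nth_rnk[OF assms])
qed

text \<open>Positions and values are renumbered by the same injective map, so a fixed point of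
  \<open>Der w\<close> would come from a fixed point of \<open>w\<close> outside
  \<open>S\<close>.\<close>

lemma Der_derangement: "Der w \<in> fixset_perms l (rnk S n) {}"
proof -
  have "Der w \<in> colperms l (rnk S n)"
  proof (rule colpermsI)
    fix x assume "x \<in> set (Der w)"
    then obtain i where i: "i \<in> {1..n} - S" "fst x = fst (w ! (i - 1))"
      by (auto simp: Der_eq set_nonfix)
    then have "w ! (i - 1) \<in> set w" using len by auto
    then show "fst x < l" using i w colpermsD(2)[of w l n] by auto
  next
    have "snd ` set (Der w) = rnk S ` p ` ({1..n} - S)"
      by (simp add: Der_eq set_nonfix image_image)
    then show "snd ` set (Der w) = {1..rnk S n}" unfolding p_nonfixed rnk_image .
  qed (rule length_Der)
  moreover have "Der w ! (j - 1) \<noteq> (0, j)" if j: "j \<in> {1..rnk S n}" for j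
  proof
    assume eq: "Der w ! (j - 1) = (0, j)"
    obtain i where i: "i \<in> {1..n} - S" "rnk S i = j" using j unfolding rnk_image[symmetric] by blast
    then have "p i \<in> {1..n} - S" using p_nonfixed by blast
    moreover have "fst (w ! (i - 1)) = 0" "rnk S (p i) = rnk S i"
      using Der_nth[OF i(1)] i(2) eq by simp_all
    ultimately have "w ! (i - 1) = (0, i)"
      using i rnk_eq_iff[of "p i" S i] by (simp add: prod_eq_iff)
    then show False using letter_not_fixed[OF i(1)] by simp
  qed
  then have "FIX (Der w) = {}" using length_Der by (auto simp: FIX_def)
  ultimately show ?thesis by simp
qed

lemma expand_Der: "expand S n (Der w) = w"
proof (rule nth_equalityI)
  show "length (expand S n (Der w)) = length w" by (simp add: expand_def len)
next
  fix k assume "k < length (expand S n (Der w))"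
  then have k: "k < n" by (simp add: expand_def del: upt_Suc)
  then have nth: "expand S n (Der w) ! k = (if Suc k \<in> S then (0, Suc k)
      else (fst (Der w ! (rnk S (Suc k) - 1)), nonfix S n ! (snd (Der w ! (rnk S (Suc k) - 1)) - 1)))"
    unfolding expand_def by (simp del: upt_Suc)
  show "expand S n (Der w) ! k = w ! k"
  proof (cases "Suc k \<in> S")
    case True
    then show ?thesis using letter_fixed[of "Suc k"] nth by simp
  next
    case False
    then have T: "Suc k \<in> {1..n} - S" using k by simp
    have "p (Suc k) \<in> {1..n} - S" using p_nonfixed T by blast
    then show ?thesis unfolding nth using False Der_nth[OF T] nonfix_nth_rnk by simp
  qed
qed

text \<open>Fixed points have colour 0, and \<open>Der\<close> keeps all other colours.\<close>

lemma col_Der: "col (Der w) = col w"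
proof -
  have "col w = (\<Sum>k<n. fst (w ! k))"
    unfolding col_def using len by (simp add: sum_list_sum_nth atLeast0LessThan)
  also have "\<dots> = (\<Sum>i\<in>{1..n}. fst (w ! (i - 1)))"
    by (rule sum.reindex_bij_witness[of _ "\<lambda>i. i - 1" Suc]) auto
  also have "\<dots> = (\<Sum>i\<in>{1..n} - S. fst (w ! (i - 1)))"
    by (rule sum.mono_neutral_right) (use letter_fixed in auto)
  also have "\<dots> = sum_list (map (\<lambda>i. fst (w ! (i - 1))) (nonfix S n))"
    unfolding set_nonfix[symmetric] by (rule sum.distinct_set_conv_list[OF distinct_nonfix])
  also have "\<dots> = col (Der w)" by (simp add: col_def Der_eq comp_def)
  finally show ?thesis by simp
qed

text \<open>A fixed point compares with a neighbouring letter only according to whether that letter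
  is an excedance, that is, uncoloured and larger than its own position. Relabelling by
  \<open>rnk S\<close> preserves this and all descents between other letters.\<close>

lemma maj_eq_mask:
  "maj w = smaj (mask_des (\<lambda>r. sig_less (Der w ! r) (Der w ! (r - 1)))
      (\<lambda>r. sig_less (0, r) (Der w ! (r - 1))) S) n"
  unfolding maj_eq_smaj len
proof (rule smaj_cong)
  fix i assume i: "1 \<le> i" "i < n"
  have pT: "p i \<in> {1..n} - S" if "i \<in> {1..n} - S" for i using p_nonfixed that by blast
  show "sig_less (w ! i) (w ! (i - 1)) = mask_des (\<lambda>r. sig_less (Der w ! r) (Der w ! (r - 1)))
      (\<lambda>r. sig_less (0, r) (Der w ! (r - 1))) S i"
  proof (cases "i \<in> S")
    case iS: True
    show ?thesis
    proof (cases "Suc i \<in> S")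
      case True
      then show ?thesis
        using letter_fixed[OF iS] letter_fixed[OF True] iS by (simp add: mask_des_def sig_less_def)
    next
      case False
      then have T: "Suc i \<in> {1..n} - S" using i by simp
      have "p (Suc i) \<in> {1..n} - S" by (rule pT[OF T])
      moreover have "w ! i \<noteq> (0, Suc i)" using letter_not_fixed[OF T] by simp
      moreover have "rnk S (Suc i) < rnk S (snd (w ! i)) \<longleftrightarrow> Suc i < snd (w ! i)"
        using pT[OF T] T by (intro rnk_less_iff) auto
      \<comment> \<open>The value \<open>i\<close> is taken by the fixed point and
        \<open>Suc i\<close> uncoloured is excluded, so comparing with \<open>i\<close> or with
        \<open>Suc i\<close> gives the same answer.\<close>
      moreover have "snd (w ! i) \<noteq> i" using pT[OF T] iS by auto
      ultimately show ?thesis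
        using letter_fixed[OF iS] Der_nth[OF T] False iS
        by (cases "w ! i") (auto simp: mask_des_def sig_less_def)
    qed
  next
    case iS: False
    then have T: "i \<in> {1..n} - S" using i by simp
    show ?thesis
    proof (cases "Suc i \<in> S")
      case True
      have "rnk S i < rnk S (p i) \<longleftrightarrow> i < p i"
        using pT[OF T] T by (intro rnk_less_iff) auto
      moreover have "p i \<noteq> Suc i" using pT[OF T] True by auto
      ultimately show ?thesis
        using letter_fixed[OF True] Der_nth[OF T] True iS
        by (auto simp: mask_des_def sig_less_def)
    next
      case False
      then have T': "Suc i \<in> {1..n} - S" using i by simp
      have "rnk S (p (Suc i)) < rnk S (p i) \<longleftrightarrow> p (Suc i) < p i"
        using pT[OF T] pT[OF T'] by (intro rnk_less_iff) auto
      moreover have "Der w ! rnk S i = (fst (w ! i), rnk S (p (Suc i)))"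
        using Der_nth[OF T'] False by (simp add: rnk_Suc)
      ultimately show ?thesis
        using Der_nth[OF T] False iS by (simp add: mask_des_def sig_less_def)
    qed
  qed
qed

lemma maf_eq_shift: "maf w = maj (Der w) + shift S"
proof -
  let ?L = "sorted_list_of_set S"
  have fin: "finite S" using S_subset finite_subset by blast
  have bij: "bij_betw ((!) ?L) {..<card S} S"
    by (rule bij_betw_nth) (use fin in auto)
  have "shift S = (\<Sum>j<card S. rnk S (?L ! j))"
    unfolding shift_def by (rule sum.reindex_bij_betw[OF bij, symmetric])
  also have "\<dots> = (\<Sum>j<card S. ?L ! j - (j + 1))"
  proof (rule sum.cong)
    fix j assume j: "j \<in> {..<card S}"
    have len_L: "length ?L = card S" using fin by simp
    have le: "?L ! i \<le> ?L ! j \<longleftrightarrow> i \<le> j" if "i < card S" for i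
      using j that len_L sorted_wrt_nth_less[OF strict_sorted_list_of_set[of S], of i j]
        sorted_wrt_nth_less[OF strict_sorted_list_of_set[of S], of j i]
      by (cases i j rule: linorder_cases) auto
    \<comment> \<open>List indices start at 0: entry \<open>j\<close> has exactly
      \<open>j + 1\<close> elements of \<open>S\<close> up to and including itself.\<close>
    have "{1..?L ! j} \<inter> S = (!) ?L ` {..j}"
    proof (intro set_eqI iffI)
      fix s assume s: "s \<in> {1..?L ! j} \<inter> S"
      then obtain i where "i < card S" "s = ?L ! i" using bij by (auto simp: bij_betw_def)
      with s le show "s \<in> (!) ?L ` {..j}" by auto
    next
      fix s assume "s \<in> (!) ?L ` {..j}"
      then obtain i where i: "i \<le> j" "s = ?L ! i" by auto
      then have "i < card S" using j by simp
      then have "s \<in> S" using i bij by (auto simp: bij_betw_def)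
      with \<open>i < card S\<close> i le S_subset show "s \<in> {1..?L ! j} \<inter> S"
        by (auto simp: bij_betw_def)
    qed
    moreover have "inj_on ((!) ?L) {..j}"
      by (rule inj_on_subset[OF bij_betw_imp_inj_on[OF bij]]) (use j in auto)
    ultimately have "card ({1..?L ! j} \<inter> S) = j + 1" by (simp add: card_image)
    then show "rnk S (?L ! j) = ?L ! j - (j + 1)"
      unfolding rnk_def by (simp add: card_Diff_subset_Int)
  qed simp
  finally show ?thesis by (simp add: maf_def FIX)
qed

end

section \<open>Rebuilding a coloured permutation from \<open>S\<close> and a derangement\<close>

context
  fixes l n S u
  assumes l: "0 < l" and S: "S \<subseteq> {1..n}" and u: "u \<in> fixset_perms l (rnk S n) {}"
begin

private lemma expand_nth:
  assumes "i \<in> {1..n}"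
  shows "expand S n u ! (i - 1) = (if i \<in> S then (0, i)
      else (fst (u ! (rnk S i - 1)), nonfix S n ! (snd (u ! (rnk S i - 1)) - 1)))"
  using assms unfolding expand_def by (subst nth_map) (auto simp del: upt_Suc)

private lemma u_mem:
  assumes "i \<in> {1..n} - S"
  shows "u ! (rnk S i - 1) \<in> set u" "snd (u ! (rnk S i - 1)) \<in> {1..rnk S n}"
proof -
  show "u ! (rnk S i - 1) \<in> set u"
    using rnk_pos[OF assms] u colpermsD(1)[of u] by (intro nth_mem) auto
  then show "snd (u ! (rnk S i - 1)) \<in> {1..rnk S n}" using u colpermsD(3)[of u l "rnk S n"] by blast
qed

text \<open>Positivity of \<open>l\<close> admits the colour 0 of the fixed points. Values in
  \<open>S\<close> are reached by these, the others through \<open>u\<close>, whose absolute values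
  cover all ranks.\<close>

lemma expand_fixset: "expand S n u \<in> fixset_perms l n S"
proof -
  have len: "length (expand S n u) = n" by (simp add: expand_def)
  have img: "set (expand S n u) = (\<lambda>i. expand S n u ! (i - 1)) ` {1..n}"
    by (rule nth_image_set[OF len])
  have u_set: "set u = (\<lambda>i. u ! (i - 1)) ` {1..rnk S n}"
    by (rule nth_image_set) (use u colpermsD(1) in auto)
  have mem: "snd (expand S n u ! (i - 1)) \<in> {1..n} - S" if i: "i \<in> {1..n} - S" for i
  proof -
    have "snd (u ! (rnk S i - 1)) - 1 < rnk S n" using u_mem(2)[OF i] by auto
    from nonfix_nth_mem[OF this] show ?thesis using expand_nth[of i] i by simp
  qed
  have colour: "fst (expand S n u ! (i - 1)) < l" if "i \<in> {1..n}" "i \<notin> S" for i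
    using expand_nth[of i] that u_mem(1)[of i] u colpermsD(2)[of u l "rnk S n"] by auto
  have "snd ` set (expand S n u) = {1..n}"
  proof (intro subset_antisym subsetI)
    fix v assume "v \<in> snd ` set (expand S n u)"
    then obtain i where i: "i \<in> {1..n}" "v = snd (expand S n u ! (i - 1))" unfolding img by auto
    then show "v \<in> {1..n}" using mem[of i] expand_nth[of i] by (cases "i \<in> S") auto
  next
    fix v assume v: "v \<in> {1..n}"
    show "v \<in> snd ` set (expand S n u)"
    proof (cases "v \<in> S")
      case True
      then show ?thesis unfolding img image_image using expand_nth[of v] v
        by (intro image_eqI[of _ _ v]) auto
    next
      case False
      then have T: "v \<in> {1..n} - S" using v by simp
      then have "rnk S v \<in> snd ` set u" using rnk_pos[OF T] u colpermsD(3)[of u] by auto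
      then obtain j where j: "j \<in> {1..rnk S n}" "rnk S v = snd (u ! (j - 1))"
        unfolding u_set by auto
      obtain i where i: "i \<in> {1..n} - S" "rnk S i = j" using j(1) unfolding rnk_image[symmetric] by blast
      have "snd (expand S n u ! (i - 1)) = v"
        using expand_nth[of i] i j nonfix_nth_rnk[OF T] by simp
      then show ?thesis unfolding img image_image using i
        by (intro image_eqI[of _ _ i]) auto
    qed
  qed
  moreover have "fst x < l" if "x \<in> set (expand S n u)" for x
  proof -
    obtain i where i: "i \<in> {1..n}" "x = expand S n u ! (i - 1)" using \<open>x \<in> _\<close> unfolding img by blast
    then show ?thesis using expand_nth[of i] l colour[of i] by (cases "i \<in> S") auto
  qed
  ultimately have perm: "expand S n u \<in> colperms l n" using len by (intro colpermsI) auto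
  \<comment> \<open>A letter \<open>(0, i)\<close> at a position outside \<open>S\<close> would make
    \<open>rnk S i\<close> a fixed point of \<open>u\<close>.\<close>
  have nofix: "expand S n u ! (i - 1) \<noteq> (0, i)" if i: "i \<in> {1..n} - S" for i
  proof
    assume eq: "expand S n u ! (i - 1) = (0, i)"
    let ?j = "rnk S i"
    have "fst (u ! (?j - 1)) = 0" and v: "nonfix S n ! (snd (u ! (?j - 1)) - 1) = i"
      using eq expand_nth[of i] i by auto
    moreover have "snd (u ! (?j - 1)) = ?j"
    proof -
      have "snd (u ! (?j - 1)) - 1 < rnk S n" using u_mem(2)[OF i] by auto
      from rnk_nonfix_nth[OF this] show ?thesis unfolding v using u_mem(2)[OF i] by simp
    qed
    ultimately have "u ! (?j - 1) = (0, ?j)" by (simp add: prod_eq_iff)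
    moreover have "?j \<in> {1..length u}" using rnk_pos[OF i] u colpermsD(1)[of u] by auto
    ultimately have "?j \<in> FIX u" by (auto simp: FIX_def)
    then show False using u by simp
  qed
  have "i \<in> FIX (expand S n u) \<longleftrightarrow> i \<in> S" for i
  proof (cases "i \<in> {1..n}")
    case True
    then show ?thesis
      using nofix[of i] expand_nth[of i] by (cases "i \<in> S") (simp_all add: FIX_def len)
  qed (use S in \<open>auto simp: FIX_def len\<close>)
  then have "FIX (expand S n u) = S" by blast
  with perm show ?thesis by simp
qed

lemma Der_expand: "Der (expand S n u) = u"
proof (rule nth_equalityI)
  show len: "length (Der (expand S n u)) = length u"
    using length_Der[OF expand_fixset] u colpermsD(1)[of u] by auto
  fix k assume "k < length (Der (expand S n u))"
  then have k: "k < rnk S n" using length_Der[OF expand_fixset] by simp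
  let ?i = "nonfix S n ! k"
  have i: "?i \<in> {1..n} - S" "rnk S ?i = Suc k"
    using nonfix_nth_mem[OF k] rnk_nonfix_nth[OF k] by auto
  have "snd (u ! k) \<in> {1..rnk S n}" using u_mem(2)[OF i(1)] i(2) by simp
  then have "rnk S (nonfix S n ! (snd (u ! k) - 1)) = snd (u ! k)"
    using rnk_nonfix_nth[of "snd (u ! k) - 1" S n] by auto
  then show "Der (expand S n u) ! k = u ! k"
    using Der_nth[OF expand_fixset i(1)] expand_nth[of ?i] i by (simp add: prod_eq_iff)
qed

end

section \<open>Generating functions over coloured permutations\<close>

definition derangement_sum :: "nat \<Rightarrow> 'a::comm_ring_1 \<Rightarrow> nat \<Rightarrow> 'a" where
  "derangement_sum l q m = (\<Sum>u\<in>fixset_perms l m {}. (q ^ l) ^ maj u * q ^ col u)"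

text \<open>\<open>Der\<close> and \<open>expand S n\<close> are inverse bijections. Any dependence
  on \<open>S\<close> is absorbed into \<open>G\<close>.\<close>

lemma sum_fixset_perms:
  fixes F :: "(nat \<times> nat) list \<Rightarrow> 'a::comm_ring_1"
  assumes "0 < l" "S \<in> subs n k" "\<And>w. w \<in> fixset_perms l n S \<Longrightarrow> F w = G (Der w)"
  shows "(\<Sum>w\<in>fixset_perms l n S. F w) = (\<Sum>u\<in>fixset_perms l (n - k) {}. G u)"
proof -
  have S: "S \<subseteq> {1..n}" and rnk: "rnk S n = n - k"
    using assms(2) rnk_subs by (auto simp: subs_def)
  show ?thesis
    unfolding rnk[symmetric]
    by (rule sum.reindex_bij_witness[of _ "expand S n" Der])
      (use assms(3) in \<open>simp_all only: expand_Der Der_expand[OF assms(1) S] Der_derangement expand_fixset[OF assms(1) S]\<close>)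
qed

lemma sum_colperms_by_FIX:
  fixes F :: "(nat \<times> nat) list \<Rightarrow> 'a::comm_ring_1"
  shows "(\<Sum>w\<in>colperms l n. F w) = (\<Sum>k\<le>n. \<Sum>S\<in>subs n k. \<Sum>w\<in>fixset_perms l n S. F w)"
proof -
  have "FIX ` colperms l n \<subseteq> Pow {1..n}"
    by (auto simp: FIX_def colpermsD(1))
  then have "(\<Sum>w\<in>colperms l n. F w) = (\<Sum>S\<in>Pow {1..n}. \<Sum>w\<in>fixset_perms l n S. F w)"
    by (intro sum.group[symmetric]) simp_all
  also have "\<dots> = (\<Sum>k\<le>n. \<Sum>S | S \<in> Pow {1..n} \<and> card S = k. \<Sum>w\<in>fixset_perms l n S. F w)"
    by (rule sum.group[symmetric]) (auto dest: card_mono[rotated])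
  finally show ?thesis by (simp add: subs_def)
qed

text \<open>After exchanging the sums, the derangement \<open>u\<close> is held fixed while
  \<open>S\<close> varies, and the inner sum is the shuffle theorem applied to
  \<open>u\<close>.\<close>

lemma sum_fmaj_fixed_points:
  fixes q :: "'a::comm_ring_1"
  assumes l: "0 < l"
  shows "(\<Sum>w\<in>colperms l n. (q ^ l) ^ maj w * q ^ col w)
    = (\<Sum>k\<le>n. gbin n k (q ^ l) * derangement_sum l q (n - k))"
  unfolding sum_colperms_by_FIX
proof (rule sum.cong)
  fix k
  let ?d = "\<lambda>u r. sig_less (u ! r) (u ! (r - 1))"
  let ?e = "\<lambda>u r. sig_less (0, r) (u ! (r - 1))"
  have "(\<Sum>S\<in>subs n k. \<Sum>w\<in>fixset_perms l n S. (q ^ l) ^ maj w * q ^ col w)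
      = (\<Sum>S\<in>subs n k. \<Sum>u\<in>fixset_perms l (n - k) {}.
          (q ^ l) ^ smaj (mask_des (?d u) (?e u) S) n * q ^ col u)"
  proof (rule sum.cong)
    fix S assume S: "S \<in> subs n k"
    show "(\<Sum>w\<in>fixset_perms l n S. (q ^ l) ^ maj w * q ^ col w)
      = (\<Sum>u\<in>fixset_perms l (n - k) {}. (q ^ l) ^ smaj (mask_des (?d u) (?e u) S) n * q ^ col u)"
      by (rule sum_fixset_perms[OF l S]) (simp only: maj_eq_mask col_Der)
  qed simp
  also have "\<dots> = (\<Sum>u\<in>fixset_perms l (n - k) {}. \<Sum>S\<in>subs n k.
          (q ^ l) ^ smaj (mask_des (?d u) (?e u) S) n * q ^ col u)"
    by (rule sum.swap)
  also have "\<dots> = (\<Sum>u\<in>fixset_perms l (n - k) {}. gbin n k (q ^ l) * ((q ^ l) ^ maj u * q ^ col u))"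
  proof (rule sum.cong)
    fix u assume u: "u \<in> fixset_perms l (n - k) {}"
    have len: "length u = n - k" using u colpermsD(1) by auto
    have nofix: "u ! (i - 1) \<noteq> (0, i)" if "1 \<le> i" "i \<le> n - k" for i
      using letter_not_fixed[OF u, of i] that by simp
    have "(\<Sum>S\<in>subs n k. (q ^ l) ^ smaj (mask_des (?d u) (?e u) S) n)
        = (q ^ l) ^ smaj (?d u) (n - k) * gbin n k (q ^ l)"
    proof (rule sum_mask_maj)
      \<comment> \<open>The letter at \<open>i\<close> is uncoloured with value above
        \<open>i\<close>; the next one is coloured or, since it is not fixed, has value at most
        \<open>i\<close>.\<close>
      fix i assume "1 \<le> i" "Suc i \<le> n - k" "?e u i" "\<not> ?e u (Suc i)"
      then show "?d u i"
        using nofix[of "Suc i"] by (cases "u ! i") (auto simp: sig_less_def)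
    next
      fix i assume "1 \<le> i" "Suc i \<le> n - k" "\<not> ?e u i" "?e u (Suc i)"
      then show "\<not> ?d u i"
        by (cases "u ! i") (auto simp: sig_less_def)
    qed
    then show "(\<Sum>S\<in>subs n k. (q ^ l) ^ smaj (mask_des (?d u) (?e u) S) n * q ^ col u)
        = gbin n k (q ^ l) * ((q ^ l) ^ maj u * q ^ col u)"
      unfolding maj_eq_smaj len sum_distrib_right[symmetric] by (simp add: mult_ac)
  qed simp
  also have "\<dots> = gbin n k (q ^ l) * derangement_sum l q (n - k)"
    unfolding derangement_sum_def by (rule sum_distrib_left[symmetric])
  finally show "(\<Sum>S\<in>subs n k. \<Sum>w\<in>fixset_perms l n S. (q ^ l) ^ maj w * q ^ col w)
      = gbin n k (q ^ l) * derangement_sum l q (n - k)" .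
qed simp

text \<open>Both sequences solve the same triangular system, obtained from the two evaluations of
  the \<open>maj\<close> sum. The term \<open>k = 0\<close> has coefficient 1, so strong induction
  determines the solution.\<close>

lemma derangement_sum_eq:
  assumes l: "0 < l"
  shows "derangement_sum l q n = g l n q 0"
proof (induction n rule: less_induct)
  case (less n)
  have split: "(\<Sum>k\<le>n. f k) = f 0 + (\<Sum>k\<in>{1..n}. f k)" for f :: "nat \<Rightarrow> 'a"
    using sum.atLeast_Suc_atMost[of 0 n f] by (simp add: atMost_atLeast0)
  have "(\<Sum>k\<le>n. gbin n k (q ^ l) * derangement_sum l q (n - k)) = (\<Prod>i\<in>{1..n}. qint (i * l) q)"
    unfolding sum_fmaj_fixed_points[OF l, symmetric] by (rule sum_fmaj_colperms)
  also have "\<dots> = (\<Sum>k\<le>n. gbin n k (q ^ l) * g l (n - k) q 0)"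
    unfolding g_at_1[symmetric] by (subst g_expand) simp
  finally have "derangement_sum l q n + (\<Sum>k\<in>{1..n}. gbin n k (q ^ l) * derangement_sum l q (n - k))
      = g l n q 0 + (\<Sum>k\<in>{1..n}. gbin n k (q ^ l) * g l (n - k) q 0)"
    unfolding split by simp
  moreover have "(\<Sum>k\<in>{1..n}. gbin n k (q ^ l) * derangement_sum l q (n - k))
      = (\<Sum>k\<in>{1..n}. gbin n k (q ^ l) * g l (n - k) q 0)"
    by (rule sum.cong) (auto intro!: arg_cong2[where f = "(*)"] less.IH)
  ultimately show ?case by simp
qed

text \<open>The weight factors into a part depending on \<open>S\<close> and one depending on
  \<open>Der w\<close>. The condition defining \<open>colperms_m\<close> concerns \<open>S\<close>
  alone, so the two sums separate into \<open>sum_shift_subs\<close> with \<open>a = n - m\<close>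
  and the derangement sum.\<close>

lemma sum_fmaf_colperms_m:
  fixes q x :: "'a::comm_ring_1"
  assumes l: "0 < l" and m: "m \<le> n"
  shows "(\<Sum>w\<in>colperms_m l n m. q ^ fmaf l w * x ^ fixp w)
    = (\<Sum>k\<le>m. x ^ k * (q ^ l) ^ ((n - m) * k) * gbin m k (q ^ l) * g l (n - k) q 0)"
proof -
  let ?f = "\<lambda>w. q ^ fmaf l w * x ^ fixp w"
  have colm: "colperms_m l n m = {w \<in> colperms l n. FIX w \<subseteq> {n - m<..}}"
  proof -
    have "(\<forall>i\<in>{1..n - m}. w ! (i - 1) \<noteq> (0, i)) \<longleftrightarrow> FIX w \<subseteq> {n - m<..}"
      if "w \<in> colperms l n" for w
    proof -
      have "w ! (i - 1) = (0, i) \<longleftrightarrow> i \<in> FIX w" if "i \<in> {1..n - m}" for i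
        using that colpermsD(1)[OF \<open>w \<in> colperms l n\<close>] by (auto simp: FIX_def)
      moreover have "FIX w \<subseteq> {1..}" by (auto simp: FIX_def)
      ultimately show ?thesis by (fastforce simp: not_le)
    qed
    then show ?thesis unfolding colperms_m_def by blast
  qed
  have "(\<Sum>w\<in>colperms_m l n m. ?f w)
      = (\<Sum>w\<in>colperms l n. if FIX w \<subseteq> {n - m<..} then ?f w else 0)"
    unfolding colm by (rule sum.inter_filter) simp
  also have "\<dots> = (\<Sum>k\<le>n. \<Sum>S\<in>subs n k. \<Sum>w\<in>fixset_perms l n S. if FIX w \<subseteq> {n - m<..} then ?f w else 0)"
    by (rule sum_colperms_by_FIX)
  also have "\<dots> = (\<Sum>k\<le>n. \<Sum>S\<in>subs n k. if S \<subseteq> {n - m<..} then (q ^ l) ^ shift S * (x ^ k * g l (n - k) q 0) else 0)"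
  proof (intro sum.cong refl)
    fix k S assume S: "S \<in> subs n k"
    have "(\<Sum>w\<in>fixset_perms l n S. ?f w)
        = (\<Sum>u\<in>fixset_perms l (n - k) {}. (q ^ l) ^ shift S * x ^ k * ((q ^ l) ^ maj u * q ^ col u))"
    proof (rule sum_fixset_perms[OF l S])
      fix w assume w: "w \<in> fixset_perms l n S"
      have "fixp w = k" using w S by (simp add: fixp_def subs_def)
      then show "?f w = (q ^ l) ^ shift S * x ^ k * ((q ^ l) ^ maj (Der w) * q ^ col (Der w))"
        unfolding fmaf_def maf_eq_shift[OF w] col_Der[OF w]
        by (simp add: power_add power_mult distrib_left mult_ac)
    qed
    also have "\<dots> = (q ^ l) ^ shift S * (x ^ k * g l (n - k) q 0)"
      unfolding sum_distrib_left[symmetric] derangement_sum_def[symmetric] derangement_sum_eq[OF l]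
      by (simp add: mult_ac)
    finally show "(\<Sum>w\<in>fixset_perms l n S. if FIX w \<subseteq> {n - m<..} then ?f w else 0)
        = (if S \<subseteq> {n - m<..} then (q ^ l) ^ shift S * (x ^ k * g l (n - k) q 0) else 0)"
      by simp
  qed
  also have "\<dots> = (\<Sum>k\<le>n. x ^ k * (q ^ l) ^ ((n - m) * k) * gbin m k (q ^ l) * g l (n - k) q 0)"
  proof (intro sum.cong refl)
    fix k
    have "(\<Sum>S\<in>subs n k. if S \<subseteq> {n - m<..} then (q ^ l) ^ shift S * (x ^ k * g l (n - k) q 0) else 0)
        = (\<Sum>S | S \<in> subs n k \<and> S \<subseteq> {n - m<..}. (q ^ l) ^ shift S) * (x ^ k * g l (n - k) q 0)"
      unfolding sum_distrib_right by (rule sum.inter_filter[symmetric]) simp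
    then show "(\<Sum>S\<in>subs n k. if S \<subseteq> {n - m<..} then (q ^ l) ^ shift S * (x ^ k * g l (n - k) q 0) else 0)
        = x ^ k * (q ^ l) ^ ((n - m) * k) * gbin m k (q ^ l) * g l (n - k) q 0"
      using sum_shift_subs[where a = "n - m" and n = n and k = k and t = "q ^ l"] m by (simp add: mult_ac)
  qed
  also have "\<dots> = (\<Sum>k\<le>m. x ^ k * (q ^ l) ^ ((n - m) * k) * gbin m k (q ^ l) * g l (n - k) q 0)"
    \<comment> \<open>Only \<open>m\<close> positions may be fixed: \<open>gbin m k\<close> vanishes
      for \<open>k > m\<close>.\<close>
    by (rule sum.mono_neutral_right) (use m in \<open>auto simp: gbin_eq_0\<close>)
  finally show ?thesis .
qed

theorem theorem2:
  fixes l n m :: nat and q x :: "'a::comm_ring_1"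
  assumes "l \<ge> 1" and "m \<le> n"
  shows "(gm l n m q x =
           (\<Sum>k\<le>n - m. (- x) ^ k * qbinom (n - m) k (q ^ l) * q ^ (l * (k choose 2))
                         * g l (n - k) q x)) \<and>
         (gm l n m q x = (\<Sum>w\<in>colperms_m l n m. q ^ fmaf l w * x ^ fixp w))"
proof
  show "gm l n m q x =
           (\<Sum>k\<le>n - m. (- x) ^ k * qbinom (n - m) k (q ^ l) * q ^ (l * (k choose 2))
                         * g l (n - k) q x)"
    using assms(2) by (simp add: gm_explicit qbinom_eq_gbin)
  show "gm l n m q x = (\<Sum>w\<in>colperms_m l n m. q ^ fmaf l w * x ^ fixp w)"
    using assms by (simp only: gm_eq_derangement_sum sum_fmaf_colperms_m)
qed

end
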